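(* Let $G$ be a nontrivial divisible (totally) ordered abelian group. Then the real closed field $K=\mathbb{R}((G))$ admits a non-surjective logarithm, i.e., a non-surjective embedding of ordered groups $(K^{>0},\cdot,1,<)\rightarrow(K,+,0,<)$.
   Context: The power series field $\mathbb{R}((G))$ consists of all formal sums $\sum_{g\in G}a_g t^g$ with $a_g\in\mathbb{R}$ and well ordered support $\{g\in G\mid a_g\neq 0\}$, with the usual addition and multiplication. Since $G$ is divisible, $K=\mathbb{R}((G))$ is real closed, and $<$ denotes its unique field order. $(K^{>0},\cdot,1,<)$ is the ordered multiplicative group of positive elements of $K$. An embedding of ordered groups is an order preserving injective group homomorphism. *)

theory Defs
  imports Complex_Main
begin

definition well_ordered_set :: "'g::linorder set \<Rightarrow> bool" where
  "well_ordered_set S \<longleftrightarrow> (\<forall>T. T \<subseteq> S \<longrightarrow> T \<noteq> {} \<longrightarrow> (\<exists>m\<in>T. \<forall>x\<in>T. m \<le> x))"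

lemma well_ordered_setD:
  assumes "well_ordered_set S" "a \<in> S" "P a"
  obtains m where "m \<in> S" "P m" "\<And>x. x \<in> S \<Longrightarrow> P x \<Longrightarrow> m \<le> x"
proof -
  have "{x\<in>S. P x} \<subseteq> S" "{x\<in>S. P x} \<noteq> {}" using assms by auto
  then obtain m where "m \<in> {x\<in>S. P x}" "\<forall>x\<in>{x\<in>S. P x}. m \<le> x"
    using assms(1) unfolding well_ordered_set_def by meson
  then show thesis using that by auto
qed

lemma well_ordered_set_subset: "well_ordered_set S \<Longrightarrow> T \<subseteq> S \<Longrightarrow> well_ordered_set T"
  unfolding well_ordered_set_def by (meson order_trans)

lemma well_ordered_set_finite: "finite S \<Longrightarrow> well_ordered_set S"
  unfolding well_ordered_set_def by (meson Min_in Min_le rev_finite_subset)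

lemma well_ordered_set_Un:
  assumes "well_ordered_set S" "well_ordered_set T"
  shows "well_ordered_set (S \<union> T)"
  unfolding well_ordered_set_def
proof (intro allI impI)
  fix U assume U: "U \<subseteq> S \<union> T" "U \<noteq> {}"
  have S: "U \<inter> S \<noteq> {} \<Longrightarrow> \<exists>m\<in>U \<inter> S. \<forall>x\<in>U \<inter> S. m \<le> x"
    using assms(1) unfolding well_ordered_set_def by blast
  have T: "U \<inter> T \<noteq> {} \<Longrightarrow> \<exists>m\<in>U \<inter> T. \<forall>x\<in>U \<inter> T. m \<le> x"
    using assms(2) unfolding well_ordered_set_def by blast
  have U': "x \<in> U \<Longrightarrow> x \<in> U \<inter> S \<or> x \<in> U \<inter> T" for x using U by auto
  consider "U \<inter> S = {}" | "U \<inter> T = {}" | "U \<inter> S \<noteq> {}" "U \<inter> T \<noteq> {}" by blast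
  then show "\<exists>m\<in>U. \<forall>x\<in>U. m \<le> x"
  proof cases
    case 1
    then have "U \<inter> T = U" using U(1) by blast
    then show ?thesis using T U(2) by simp
  next
    case 2
    then have "U \<inter> S = U" using U(1) by blast
    then show ?thesis using S U(2) by simp
  next
    case 3
    obtain a where a: "a \<in> U \<inter> S" "\<forall>x\<in>U \<inter> S. a \<le> x" using S 3(1) by blast
    obtain b where b: "b \<in> U \<inter> T" "\<forall>x\<in>U \<inter> T. b \<le> x" using T 3(2) by blast
    have "\<forall>x\<in>U. min a b \<le> x" using a b U' by (meson min.coboundedI1 min.coboundedI2)
    moreover have "min a b \<in> U" using a b by (simp add: min_def)
    ultimately show ?thesis by blast
  qed
qed

lemma finite_if_min_max:
  fixes A :: "'g::linorder set"
  assumes min: "well_ordered_set A"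
    and max: "\<And>B. B \<subseteq> A \<Longrightarrow> B \<noteq> {} \<Longrightarrow> \<exists>m\<in>B. \<forall>x\<in>B. x \<le> m"
  shows "finite A"
proof (cases "A = {}")
  case False
  define B where "B = {a\<in>A. finite {x\<in>A. x \<le> a}}"
  obtain m0 where m0: "m0 \<in> A" "\<forall>x\<in>A. m0 \<le> x"
    using min False unfolding well_ordered_set_def by blast
  have "{x\<in>A. x \<le> m0} \<subseteq> {m0}" using m0 by (auto intro: antisym)
  then have "m0 \<in> B" unfolding B_def using m0(1) by (simp add: finite_subset)
  then obtain m where m: "m \<in> B" "\<forall>x\<in>B. x \<le> m"
    using max[of B] unfolding B_def by auto
  have "x \<le> m" if "x \<in> A" for x
  proof (rule ccontr)
    assume "\<not> x \<le> m"
    then have "m < x" by simp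
    from well_ordered_setD[OF min that, of "\<lambda>x. m < x", OF this]
    obtain s where s: "s \<in> A" "m < s" "\<And>x. x \<in> A \<Longrightarrow> m < x \<Longrightarrow> s \<le> x" by blast
    have "{x\<in>A. x \<le> s} \<subseteq> insert s {x\<in>A. x \<le> m}" using s(3) by (auto simp: not_le antisym not_less intro: leI)
    moreover have "finite {x\<in>A. x \<le> m}" using m(1) B_def by blast
    ultimately have "s \<in> B" unfolding B_def using s(1) by (simp add: finite_subset)
    then show False using m(2) s(2) by auto
  qed
  then have "A = {x\<in>A. x \<le> m}" by blast
  then show ?thesis using m(1) B_def by auto
qed simp

lemma finite_sum_fibre:
  fixes S T :: "'g::linordered_ab_group_add set"
  assumes S: "well_ordered_set S" and T: "well_ordered_set T"
  shows "finite {(a, b). a \<in> S \<and> b \<in> T \<and> a + b = g}"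
proof -
  define A where "A = {a\<in>S. g - a \<in> T}"
  have "finite A"
  proof (rule finite_if_min_max)
    show "well_ordered_set A" by (rule well_ordered_set_subset[OF S]) (auto simp: A_def)
    fix B assume B: "B \<subseteq> A" "B \<noteq> {}"
    have "(\<lambda>a. g - a) ` B \<subseteq> T" "(\<lambda>a. g - a) ` B \<noteq> {}" using B by (auto simp: A_def)
    then obtain m where m: "m \<in> B" "\<forall>x\<in>(\<lambda>a. g - a) ` B. g - m \<le> x"
      using T unfolding well_ordered_set_def by (metis (no_types, lifting) imageE)
    have "\<forall>x\<in>B. x \<le> m" using m(2) by auto
    then show "\<exists>m\<in>B. \<forall>x\<in>B. x \<le> m" using m(1) by blast
  qed
  moreover have "{(a, b). a \<in> S \<and> b \<in> T \<and> a + b = g} \<subseteq> (\<lambda>a. (a, g - a)) ` A"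
    by (auto simp: A_def image_iff algebra_simps)
  ultimately show ?thesis by (meson finite_imageI finite_subset)
qed

lemma well_ordered_set_sums:
  fixes S T :: "'g::linordered_ab_group_add set"
  assumes S: "well_ordered_set S" and T: "well_ordered_set T"
  shows "well_ordered_set {a + b |a b. a \<in> S \<and> b \<in> T}"
  unfolding well_ordered_set_def
proof (intro allI impI, rule ccontr)
  fix U assume U: "U \<subseteq> {a + b |a b. a \<in> S \<and> b \<in> T}" "U \<noteq> {}"
    and "\<not> (\<exists>m\<in>U. \<forall>x\<in>U. m \<le> x)"
  then have nomin: "\<And>m. m \<in> U \<Longrightarrow> \<exists>x\<in>U. x < m" by (meson not_le)
  define P where "P = (\<lambda>s t. s \<in> S \<and> t \<in> T \<and> s + t \<in> U)"
  \<comment> \<open>For \<open>Q s t\<close>, any smaller sum in \<open>U\<close> uses a strictly smaller second summand.\<close>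
  define Q where "Q = (\<lambda>s t. P s t \<and> (\<forall>s' t'. P s' t' \<longrightarrow> s' + t' < s + t \<longrightarrow> s \<le> s'))"
  have step: "\<exists>s' t'. Q s' t' \<and> t' < t" if "Q s t" for s t
  proof -
    have "s + t \<in> U" using that by (simp add: Q_def P_def)
    then obtain x where x: "x \<in> U" "x < s + t" using nomin by blast
    then obtain a b where ab: "P a b" "a + b < s + t" using U(1) unfolding P_def by blast
    have "a \<in> S" "\<exists>b. P a b \<and> a + b < s + t" using ab unfolding P_def by auto
    from well_ordered_setD[where P = "\<lambda>s'. \<exists>b. P s' b \<and> s' + b < s + t", OF S this] obtain s' where s': "\<exists>b. P s' b \<and> s' + b < s + t"
      "\<And>x. x \<in> S \<Longrightarrow> \<exists>b. P x b \<and> x + b < s + t \<Longrightarrow> s' \<le> x" by metis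
    then obtain t' where t': "P s' t'" "s' + t' < s + t" by blast
    have "Q s' t'" unfolding Q_def
    proof (intro conjI allI impI)
      fix s2 t2 assume 1: "P s2 t2" "s2 + t2 < s' + t'"
      then have "s2 + t2 < s + t" using t'(2) by order
      then show "s' \<le> s2" using s'(2)[of s2] 1(1) unfolding P_def by blast
    qed (rule t')
    moreover have "s \<le> s'" using that t' unfolding Q_def by blast
    then have "t' < t" using t'(2) by (meson add_mono not_le)
    ultimately show ?thesis by blast
  qed
  obtain u where "u \<in> U" using U(2) by blast
  then obtain a b where ab: "P a b" using U(1) unfolding P_def by blast
  then have "a \<in> S" "\<exists>b. P a b" unfolding P_def by auto
  from well_ordered_setD[where P = "\<lambda>s. \<exists>b. P s b", OF S this] obtain s where s: "\<exists>b. P s b"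
    "\<And>x. x \<in> S \<Longrightarrow> \<exists>b. P x b \<Longrightarrow> s \<le> x" by metis
  then obtain t where t: "P s t" by blast
  have "Q s t" unfolding Q_def using t s(2) P_def by blast
  then have "t \<in> T" "\<exists>s. Q s t" unfolding Q_def P_def by auto
  from well_ordered_setD[where P = "\<lambda>t. \<exists>s. Q s t", OF T this] obtain m where m: "\<exists>s. Q s m"
    "\<And>x. x \<in> T \<Longrightarrow> \<exists>s. Q s x \<Longrightarrow> m \<le> x" by metis
  then obtain s' t' where "Q s' t'" "t' < m" using step by blast
  then have "t' \<in> T" "\<exists>s. Q s t'" unfolding Q_def P_def by auto
  with m(2) \<open>t' < m\<close> show False by fastforce
qed

typedef (overloaded) 'g hahn =
  "{f :: 'g::linordered_ab_group_add \<Rightarrow> real. well_ordered_set {g. f g \<noteq> 0}}"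
  morphisms hcoeff Abs_hahn
  by (rule exI[of _ "\<lambda>_. 0"]) (simp add: well_ordered_set_def)

definition hsupp :: "'g::linordered_ab_group_add hahn \<Rightarrow> 'g set" where
  "hsupp x = {g. hcoeff x g \<noteq> 0}"

lemma hsupp_well_ordered: "well_ordered_set (hsupp x)"
  using hcoeff[of x] by (simp add: hsupp_def)

lemma hahn_eqI: "(\<And>g. hcoeff x g = hcoeff y g) \<Longrightarrow> x = y"
  by (metis hcoeff_inject ext)

lemma hcoeff_Abs:
  assumes "well_ordered_set S" "\<And>g. f g \<noteq> 0 \<Longrightarrow> g \<in> S"
  shows "hcoeff (Abs_hahn f) g = f g"
proof -
  have "well_ordered_set {g. f g \<noteq> 0}"
    by (rule well_ordered_set_subset[OF assms(1)]) (use assms(2) in auto)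
  then show ?thesis by (simp add: Abs_hahn_inverse)
qed

instantiation hahn :: (linordered_ab_group_add) comm_ring_1
begin

definition zero_hahn :: "'a hahn" where "0 = Abs_hahn (\<lambda>_. 0)"

definition one_hahn :: "'a hahn" where "1 = Abs_hahn (\<lambda>g. if g = 0 then 1 else 0)"

definition plus_hahn :: "'a hahn \<Rightarrow> 'a hahn \<Rightarrow> 'a hahn" where
  "x + y = Abs_hahn (\<lambda>g. hcoeff x g + hcoeff y g)"

definition uminus_hahn :: "'a hahn \<Rightarrow> 'a hahn" where
  "- x = Abs_hahn (\<lambda>g. - hcoeff x g)"

definition minus_hahn :: "'a hahn \<Rightarrow> 'a hahn \<Rightarrow> 'a hahn" where
  "x - y = Abs_hahn (\<lambda>g. hcoeff x g - hcoeff y g)"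

definition times_hahn :: "'a hahn \<Rightarrow> 'a hahn \<Rightarrow> 'a hahn" where
  "x * y = Abs_hahn (\<lambda>g. \<Sum>(a, b)\<in>{(a, b). a \<in> hsupp x \<and> b \<in> hsupp y \<and> a + b = g}.
     hcoeff x a * hcoeff y b)"

lemma hcoeff_0 [simp]: "hcoeff (0 :: 'a hahn) g = 0"
  unfolding zero_hahn_def by (rule hcoeff_Abs[of "{}"]) (auto simp: well_ordered_set_finite)

lemma hcoeff_1: "hcoeff (1 :: 'a hahn) g = (if g = 0 then 1 else 0)"
  unfolding one_hahn_def
  by (rule hcoeff_Abs[of "{0}"]) (auto simp: well_ordered_set_finite split: if_splits)

lemma hcoeff_add [simp]: "hcoeff (x + y :: 'a hahn) g = hcoeff x g + hcoeff y g"
  unfolding plus_hahn_def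
  by (rule hcoeff_Abs[OF well_ordered_set_Un[OF hsupp_well_ordered[of x] hsupp_well_ordered[of y]]])
    (auto simp: hsupp_def)

lemma hcoeff_minus [simp]: "hcoeff (- x :: 'a hahn) g = - hcoeff x g"
  unfolding uminus_hahn_def by (rule hcoeff_Abs[OF hsupp_well_ordered[of x]]) (auto simp: hsupp_def)

lemma hcoeff_diff [simp]: "hcoeff (x - y :: 'a hahn) g = hcoeff x g - hcoeff y g"
  unfolding minus_hahn_def
  by (rule hcoeff_Abs[OF well_ordered_set_Un[OF hsupp_well_ordered[of x] hsupp_well_ordered[of y]]])
    (auto simp: hsupp_def)

lemma hcoeff_mult:
  "hcoeff (x * y :: 'a hahn) g =
    (\<Sum>(a, b)\<in>{(a, b). a \<in> hsupp x \<and> b \<in> hsupp y \<and> a + b = g}. hcoeff x a * hcoeff y b)"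
  unfolding times_hahn_def
proof (rule hcoeff_Abs[OF well_ordered_set_sums[OF hsupp_well_ordered[of x] hsupp_well_ordered[of y]]])
  fix g
  assume "(\<Sum>(a, b)\<in>{(a, b). a \<in> hsupp x \<and> b \<in> hsupp y \<and> a + b = g}.
    hcoeff x a * hcoeff y b) \<noteq> 0"
  then have "{(a, b). a \<in> hsupp x \<and> b \<in> hsupp y \<and> a + b = g} \<noteq> {}"
    by (metis sum.empty)
  then show "g \<in> {a + b |a b. a \<in> hsupp x \<and> b \<in> hsupp y}" by blast
qed

lemma hcoeff_mult_superset:
  assumes "well_ordered_set A" "well_ordered_set B" "hsupp x \<subseteq> A" "hsupp y \<subseteq> B"
  shows "hcoeff (x * y :: 'a hahn) g =
    (\<Sum>(a, b)\<in>{(a, b). a \<in> A \<and> b \<in> B \<and> a + b = g}. hcoeff x a * hcoeff y b)"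
  unfolding hcoeff_mult
  by (rule sum.mono_neutral_left)
    (use assms in \<open>auto intro!: finite_sum_fibre simp: hsupp_def\<close>)

lemma hsupp_mult: "hsupp (x * y :: 'a hahn) \<subseteq> {a + b |a b. a \<in> hsupp x \<and> b \<in> hsupp y}"
proof
  fix g assume "g \<in> hsupp (x * y)"
  then have "hcoeff (x * y) g \<noteq> 0" by (simp add: hsupp_def)
  then have "{(a, b). a \<in> hsupp x \<and> b \<in> hsupp y \<and> a + b = g} \<noteq> {}"
    unfolding hcoeff_mult by (metis sum.empty)
  then show "g \<in> {a + b |a b. a \<in> hsupp x \<and> b \<in> hsupp y}" by blast
qed

lemma hahn_mult_commute: "x * y = y * (x :: 'a hahn)"
proof (rule hahn_eqI)
  fix g
  show "hcoeff (x * y) g = hcoeff (y * x) g"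
    unfolding hcoeff_mult
    by (rule sum.reindex_bij_witness[of _ "\<lambda>(a, b). (b, a)" "\<lambda>(a, b). (b, a)"])
      (auto simp: ac_simps)
qed

lemma hahn_mult_triple:
  "hcoeff ((x * y) * z :: 'a hahn) g =
    (\<Sum>(a, b, c)\<in>{(a, b, c). a \<in> hsupp x \<and> b \<in> hsupp y \<and> c \<in> hsupp z \<and> a + b + c = g}.
      hcoeff x a * hcoeff y b * hcoeff z c)"
proof -
  let ?A = "hsupp x" and ?B = "hsupp y" and ?C = "hsupp z"
  let ?D = "{a + b |a b. a \<in> ?A \<and> b \<in> ?B}"
  let ?P = "{(d, c). d \<in> ?D \<and> c \<in> ?C \<and> d + c = g}"
  let ?F = "\<lambda>d. {(a, b). a \<in> ?A \<and> b \<in> ?B \<and> a + b = d}"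
  have D: "well_ordered_set ?D" by (intro well_ordered_set_sums hsupp_well_ordered)
  have "hcoeff ((x * y) * z) g = (\<Sum>(d, c)\<in>?P. hcoeff (x * y) d * hcoeff z c)"
    by (rule hcoeff_mult_superset[OF D hsupp_well_ordered hsupp_mult]) simp
  also have "\<dots> = (\<Sum>p\<in>?P. \<Sum>q\<in>?F (fst p). hcoeff x (fst q) * hcoeff y (snd q) * hcoeff z (snd p))"
    by (rule sum.cong) (auto simp: hcoeff_mult sum_distrib_right case_prod_beta)
  also have "\<dots> = (\<Sum>(p, q)\<in>Sigma ?P (\<lambda>p. ?F (fst p)).
      hcoeff x (fst q) * hcoeff y (snd q) * hcoeff z (snd p))"
    by (rule sum.Sigma) (use finite_sum_fibre[OF D hsupp_well_ordered] in
      \<open>auto intro!: finite_sum_fibre hsupp_well_ordered\<close>)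
  also have "\<dots> = (\<Sum>(a, b, c)\<in>{(a, b, c). a \<in> ?A \<and> b \<in> ?B \<and> c \<in> ?C \<and> a + b + c = g}.
      hcoeff x a * hcoeff y b * hcoeff z c)"
    by (rule sum.reindex_bij_witness[of _ "\<lambda>(a, b, c). ((a + b, c), (a, b))"
          "\<lambda>((d, c), (a, b)). (a, b, c)"]) auto
  finally show ?thesis .
qed

lemma hahn_mult_assoc: "(x * y) * z = x * (y * z :: 'a hahn)"
proof (rule hahn_eqI)
  fix g
  have "hcoeff (x * (y * z)) g = hcoeff ((y * z) * x) g" by (simp only: hahn_mult_commute)
  also have "\<dots> = hcoeff ((x * y) * z) g"
    unfolding hahn_mult_triple
    by (rule sum.reindex_bij_witness[of _ "\<lambda>(a, b, c). (b, c, a)" "\<lambda>(b, c, a). (a, b, c)"])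
      (auto simp: ac_simps)
  finally show "hcoeff ((x * y) * z) g = hcoeff (x * (y * z)) g" by simp
qed

lemma hahn_distrib: "(x + y) * z = x * z + y * (z :: 'a hahn)"
proof (rule hahn_eqI)
  fix g
  let ?A = "hsupp x \<union> hsupp y"
  have A: "well_ordered_set ?A" by (intro well_ordered_set_Un hsupp_well_ordered)
  have "hsupp (x + y) \<subseteq> ?A" by (auto simp: hsupp_def)
  then have "hcoeff ((x + y) * z) g = (\<Sum>(a, b)\<in>{(a, b). a \<in> ?A \<and> b \<in> hsupp z \<and> a + b = g}.
      hcoeff (x + y) a * hcoeff z b)"
    by (intro hcoeff_mult_superset A hsupp_well_ordered) auto
  also have "\<dots> = (\<Sum>(a, b)\<in>{(a, b). a \<in> ?A \<and> b \<in> hsupp z \<and> a + b = g}.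
      hcoeff x a * hcoeff z b) + (\<Sum>(a, b)\<in>{(a, b). a \<in> ?A \<and> b \<in> hsupp z \<and> a + b = g}.
      hcoeff y a * hcoeff z b)"
    by (simp add: sum.distrib[symmetric] case_prod_beta distrib_right)
  also have "\<dots> = hcoeff (x * z) g + hcoeff (y * z) g"
    by (simp add: hcoeff_mult_superset[OF A hsupp_well_ordered _ order_refl])
  finally show "hcoeff ((x + y) * z) g = hcoeff (x * z + y * z) g" by simp
qed

lemma hahn_1_mult: "1 * x = (x :: 'a hahn)"
proof (rule hahn_eqI)
  fix g
  have "hcoeff (1 * x) g = (\<Sum>(a, b)\<in>{(a, b). a \<in> {0} \<and> b \<in> insert g (hsupp x) \<and> a + b = g}.
      hcoeff 1 a * hcoeff x b)"
  proof (rule hcoeff_mult_superset)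
    show "well_ordered_set (insert g (hsupp x))"
      using well_ordered_set_Un[OF well_ordered_set_finite hsupp_well_ordered, of "{g}" x] by simp
  qed (auto simp: well_ordered_set_finite hsupp_def hcoeff_1 split: if_splits)
  also have "{(a, b). a \<in> {0} \<and> b \<in> insert g (hsupp x) \<and> a + b = g} = {(0, g)}" by auto
  finally show "hcoeff (1 * x) g = hcoeff x g" by (simp add: hcoeff_1)
qed

instance
proof
  show "0 \<noteq> (1 :: 'a hahn)" by (metis hcoeff_0 hcoeff_1 zero_neq_one)
qed (rule hahn_mult_assoc hahn_mult_commute hahn_1_mult hahn_distrib | rule hahn_eqI, simp)+

end

instantiation hahn :: (linordered_ab_group_add) linordered_idom
begin

text \<open>Two series are compared at the least exponent at which they differ; in particular
  a series is positive iff its leading coefficient (the one at the minimum of the support) is.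
  This is the only field order if the exponent group is divisible, see \<open>hahn_order_unique\<close>.\<close>

definition less_hahn :: "'a hahn \<Rightarrow> 'a hahn \<Rightarrow> bool" where
  "x < y \<longleftrightarrow> (\<exists>g. hcoeff x g < hcoeff y g \<and> (\<forall>h<g. hcoeff x h = hcoeff y h))"

definition less_eq_hahn :: "'a hahn \<Rightarrow> 'a hahn \<Rightarrow> bool" where
  "x \<le> y \<longleftrightarrow> x < y \<or> x = (y :: 'a hahn)"

definition abs_hahn :: "'a hahn \<Rightarrow> 'a hahn" where
  "\<bar>x\<bar> = (if x < 0 then - x else (x :: 'a hahn))"

definition sgn_hahn :: "'a hahn \<Rightarrow> 'a hahn" where
  "sgn x = (if x = 0 then 0 else if 0 < x then 1 else - 1 :: 'a hahn)"

lemma hahn_first_difference: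
  fixes x y :: "'a hahn"
  assumes "x \<noteq> y"
  obtains g where "hcoeff x g \<noteq> hcoeff y g" "\<And>h. h < g \<Longrightarrow> hcoeff x h = hcoeff y h"
proof -
  obtain g0 where g0: "hcoeff x g0 \<noteq> hcoeff y g0" using assms hahn_eqI by blast
  then have "g0 \<in> hsupp x \<union> hsupp y" by (auto simp: hsupp_def)
  from well_ordered_setD[OF well_ordered_set_Un[OF hsupp_well_ordered hsupp_well_ordered] this,
      of "\<lambda>g. hcoeff x g \<noteq> hcoeff y g", OF g0]
  obtain g where g: "hcoeff x g \<noteq> hcoeff y g"
    "\<And>h. h \<in> hsupp x \<union> hsupp y \<Longrightarrow> hcoeff x h \<noteq> hcoeff y h \<Longrightarrow> g \<le> h" by blast
  have "hcoeff x h = hcoeff y h" if "h < g" for h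
    using g(2)[of h] that by (cases "hcoeff x h = hcoeff y h") (auto simp: hsupp_def)
  with g(1) show thesis using that by blast
qed

lemma hahn_less_linear: "x < y \<or> x = y \<or> y < (x :: 'a hahn)"
proof (cases "x = y")
  case False
  then obtain g where "hcoeff x g \<noteq> hcoeff y g" "\<And>h. h < g \<Longrightarrow> hcoeff x h = hcoeff y h"
    using hahn_first_difference by blast
  then show ?thesis unfolding less_hahn_def by (metis linorder_neqE)
qed simp

lemma hahn_less_trans:
  fixes x y z :: "'a hahn"
  assumes "x < y" "y < z"
  shows "x < z"
proof -
  obtain g where g: "hcoeff x g < hcoeff y g" "\<And>h. h < g \<Longrightarrow> hcoeff x h = hcoeff y h"
    using assms(1) unfolding less_hahn_def by blast
  obtain k where k: "hcoeff y k < hcoeff z k" "\<And>h. h < k \<Longrightarrow> hcoeff y h = hcoeff z h"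
    using assms(2) unfolding less_hahn_def by blast
  have "hcoeff x (min g k) < hcoeff z (min g k)"
    using g k by (cases g k rule: linorder_cases) (auto simp: min_def)
  moreover have "\<forall>h<min g k. hcoeff x h = hcoeff z h" using g(2) k(2) by simp
  ultimately show ?thesis unfolding less_hahn_def by blast
qed

lemma hahn_less_irrefl: "\<not> x < (x :: 'a hahn)"
  by (simp add: less_hahn_def)

lemma hahn_pos_iff: "0 < (x :: 'a hahn) \<longleftrightarrow> (\<exists>g. 0 < hcoeff x g \<and> (\<forall>h<g. hcoeff x h = 0))"
  by (auto simp: less_hahn_def)

lemma hcoeff_mult_leading:
  fixes x y :: "'a hahn"
  assumes "\<And>h. h < a \<Longrightarrow> hcoeff x h = 0" "\<And>h. h < b \<Longrightarrow> hcoeff y h = 0"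
  shows "hcoeff (x * y) (a + b) = hcoeff x a * hcoeff y b"
    and "g < a + b \<Longrightarrow> hcoeff (x * y) g = 0"
proof -
  have a: "a \<le> h" if "h \<in> hsupp x" for h using assms(1)[of h] that by (auto simp: hsupp_def intro: leI)
  have b: "b \<le> h" if "h \<in> hsupp y" for h using assms(2)[of h] that by (auto simp: hsupp_def intro: leI)
  have wf: "well_ordered_set (insert a (hsupp x))" "well_ordered_set (insert b (hsupp y))"
    using well_ordered_set_Un[OF well_ordered_set_finite hsupp_well_ordered, of "{a}" x]
      well_ordered_set_Un[OF well_ordered_set_finite hsupp_well_ordered, of "{b}" y] by simp_all
  have ab: "p = a \<and> q = b" if "p + q = a + b" "a \<le> p" "b \<le> q" for p q
    using that add_less_le_mono[of a p b q] add_le_less_mono[of a p b q]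
    by (auto simp: order_le_less)
  have "{(p, q). p \<in> insert a (hsupp x) \<and> q \<in> insert b (hsupp y) \<and> p + q = a + b} = {(a, b)}"
    using a b ab by fastforce
  with hcoeff_mult_superset[OF wf, of x y "a + b"]
  show "hcoeff (x * y) (a + b) = hcoeff x a * hcoeff y b" by auto
  assume g: "g < a + b"
  have "p + q \<noteq> g" if "p \<in> hsupp x" "q \<in> hsupp y" for p q
    using add_mono[OF a[OF that(1)] b[OF that(2)]] g by auto
  then have "{(p, q). p \<in> hsupp x \<and> q \<in> hsupp y \<and> p + q = g} = {}" by blast
  then show "hcoeff (x * y) g = 0" unfolding hcoeff_mult by (metis sum.empty)
qed

lemma hahn_mult_pos:
  fixes x y :: "'a hahn"
  assumes "0 < x" "0 < y"
  shows "0 < x * y"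
proof -
  obtain a where a: "0 < hcoeff x a" "\<And>h. h < a \<Longrightarrow> hcoeff x h = 0"
    using assms(1) hahn_pos_iff by blast
  obtain b where b: "0 < hcoeff y b" "\<And>h. h < b \<Longrightarrow> hcoeff y h = 0"
    using assms(2) hahn_pos_iff by blast
  from hcoeff_mult_leading[of a x b y, OF a(2) b(2)] a(1) b(1)
  have "0 < hcoeff (x * y) (a + b) \<and> (\<forall>h<a + b. hcoeff (x * y) h = 0)" by simp
  then show ?thesis using hahn_pos_iff by blast
qed

lemma hahn_less_diff: "x < y \<longleftrightarrow> 0 < y - (x :: 'a hahn)"
  by (auto simp: less_hahn_def)

instance
proof
  fix x y z :: "'a hahn"
  show "x < y \<longleftrightarrow> x \<le> y \<and> \<not> y \<le> x"
    unfolding less_eq_hahn_def using hahn_less_irrefl hahn_less_trans by metis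
  show "x \<le> x" by (simp add: less_eq_hahn_def)
  show "x \<le> y \<Longrightarrow> y \<le> z \<Longrightarrow> x \<le> z"
    unfolding less_eq_hahn_def using hahn_less_trans by metis
  show "x \<le> y \<Longrightarrow> y \<le> x \<Longrightarrow> x = y"
    unfolding less_eq_hahn_def using hahn_less_irrefl hahn_less_trans by metis
  show "x \<le> y \<or> y \<le> x" unfolding less_eq_hahn_def using hahn_less_linear by metis
  show "x \<le> y \<Longrightarrow> z + x \<le> z + y" unfolding less_eq_hahn_def less_hahn_def by auto
  show "x < y \<Longrightarrow> 0 < z \<Longrightarrow> z * x < z * y"
    using hahn_mult_pos[of z "y - x"] by (simp add: hahn_less_diff[of x y] hahn_less_diff[of "z * x"] right_diff_distrib)
qed (auto simp: abs_hahn_def sgn_hahn_def)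

end

text \<open>A map is strictly contracting for the valuation if the coefficient of its value at \<open>g\<close>
  only depends on the coefficients of the argument below \<open>g\<close>.  The fixed point is
  the union of the coherent family of initial segments of would-be solutions.\<close>

lemma hahn_fixed_point:
  fixes F :: "'g::linordered_ab_group_add hahn \<Rightarrow> 'g hahn"
  assumes contr: "\<And>x y g. (\<And>h. h < g \<Longrightarrow> hcoeff x h = hcoeff y h) \<Longrightarrow> hcoeff (F x) g = hcoeff (F y) g"
  shows "\<exists>x. F x = x"
proof -
  define good where
    "good = (\<lambda>y. \<forall>g\<in>hsupp y. \<forall>h\<le>g. hcoeff (F y) h = hcoeff y h)"
  have goodD: "hcoeff (F y) h = hcoeff y h" if "good y" "hcoeff y g \<noteq> 0" "h \<le> g" for y g h
    using that unfolding good_def hsupp_def by blast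
  have coherent: "hcoeff y h = hcoeff z h"
    if y: "good y" "hcoeff y k \<noteq> 0" and z: "good z" "hcoeff z l \<noteq> 0" and h: "h \<le> k" "h \<le> l"
    for y z k l h
  proof (rule ccontr)
    assume ne: "hcoeff y h \<noteq> hcoeff z h"
    then have "y \<noteq> z" by blast
    then obtain g where g: "hcoeff y g \<noteq> hcoeff z g" "\<And>h. h < g \<Longrightarrow> hcoeff y h = hcoeff z h"
      using hahn_first_difference by blast
    have "g \<le> h" using g(2) ne by (meson not_le)
    then have "hcoeff (F y) g = hcoeff y g" "hcoeff (F z) g = hcoeff z g"
      using goodD y z h by (meson order_trans)+
    moreover have "hcoeff (F y) g = hcoeff (F z) g" using contr g(2) by blast
    ultimately show False using g(1) by simp
  qed
  have agree: "hcoeff y h = hcoeff z h"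
    if y: "good y" "hcoeff y k \<noteq> 0" and z: "good z" "hcoeff z h \<noteq> 0" and h: "h \<le> k" for y z k h
    using coherent[OF y z h] by simp
  define c where
    "c = (\<lambda>g. if \<exists>y. good y \<and> hcoeff y g \<noteq> 0
      then hcoeff (SOME y. good y \<and> hcoeff y g \<noteq> 0) g else 0)"
  have c: "c h = hcoeff y h" if y: "good y" "hcoeff y k \<noteq> 0" and h: "h \<le> k" for y k h
  proof (cases "\<exists>y. good y \<and> hcoeff y h \<noteq> 0")
    case True
    then have "good (SOME y. good y \<and> hcoeff y h \<noteq> 0) \<and> hcoeff (SOME y. good y \<and> hcoeff y h \<noteq> 0) h \<noteq> 0"
      by (rule someI_ex)
    with agree[OF y, of "SOME y. good y \<and> hcoeff y h \<noteq> 0" h] h show ?thesis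
      using True by (simp add: c_def)
  next
    case False
    then show ?thesis using y(1) by (auto simp: c_def)
  qed
  have c_ex: "\<exists>y. good y \<and> hcoeff y g \<noteq> 0" if "c g \<noteq> 0" for g
    using that unfolding c_def by presburger
  have wo: "well_ordered_set {g. c g \<noteq> 0}"
    unfolding well_ordered_set_def
  proof (intro allI impI)
    fix T assume T: "T \<subseteq> {g. c g \<noteq> 0}" "T \<noteq> {}"
    then obtain t where t: "t \<in> T" "c t \<noteq> 0" by blast
    then obtain y where y: "good y" "hcoeff y t \<noteq> 0" using c_ex by blast
    have "t \<in> hsupp y" using y by (simp add: hsupp_def)
    from well_ordered_setD[OF hsupp_well_ordered this, of "\<lambda>g. g \<in> T", OF t(1)]
    obtain m where m: "m \<in> T" "\<And>x. x \<in> hsupp y \<Longrightarrow> x \<in> T \<Longrightarrow> m \<le> x" by blast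
    have "m \<le> x" if "x \<in> T" for x
    proof (cases "x \<le> t")
      case True
      then have "x \<in> hsupp y" using c[OF y True] T(1) that by (auto simp: hsupp_def)
      then show ?thesis using m(2) that by blast
    next
      case False
      have "m \<le> t" using m(2) t(1) \<open>t \<in> hsupp y\<close> by blast
      then show ?thesis using False by simp
    qed
    then show "\<exists>m\<in>T. \<forall>x\<in>T. m \<le> x" using m(1) by blast
  qed
  define Y where "Y = Abs_hahn c"
  have Y: "hcoeff Y g = c g" for g unfolding Y_def by (rule hcoeff_Abs[OF wo]) simp
  have goodY: "good Y" unfolding good_def
  proof (intro ballI allI impI)
    fix g h assume g: "g \<in> hsupp Y" and h: "h \<le> g"
    then obtain y where y: "good y" "hcoeff y g \<noteq> 0" using c_ex Y by (auto simp: hsupp_def)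
    have eq: "hcoeff Y k = hcoeff y k" if "k \<le> g" for k using c[OF y that] Y by simp
    have "hcoeff (F Y) h = hcoeff (F y) h" using contr[of h Y y] eq h by simp
    also have "\<dots> = hcoeff y h" using goodD y h by blast
    finally show "hcoeff (F Y) h = hcoeff Y h" using eq h by simp
  qed
  have "F Y = Y"
  proof (rule ccontr)
    assume "F Y \<noteq> Y"
    then obtain g where g: "hcoeff (F Y) g \<noteq> hcoeff Y g" "\<And>h. h < g \<Longrightarrow> hcoeff (F Y) h = hcoeff Y h"
      using hahn_first_difference by blast
    have above: "hcoeff Y h = 0" if "g \<le> h" for h
      using goodD[OF goodY _ that] g(1) by blast
    define Z where "Z = Abs_hahn (\<lambda>h. if h = g then hcoeff (F Y) g else hcoeff Y h)"
    have "well_ordered_set (insert g (hsupp Y))"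
      using well_ordered_set_Un[OF well_ordered_set_finite hsupp_well_ordered, of "{g}" Y] by simp
    then have Z: "hcoeff Z h = (if h = g then hcoeff (F Y) g else hcoeff Y h)" for h
      unfolding Z_def by (rule hcoeff_Abs) (auto simp: hsupp_def)
    have FZ: "hcoeff (F Z) h = hcoeff Z h" if "h \<le> g" for h
    proof -
      have "hcoeff (F Z) h = hcoeff (F Y) h" by (rule contr) (use that in \<open>auto simp: Z\<close>)
      then show ?thesis using g(2) that by (auto simp: Z)
    qed
    have "good Z" unfolding good_def
    proof (intro ballI allI impI)
      fix k h assume "k \<in> hsupp Z" "h \<le> k"
      moreover have "k \<le> g"
      proof (rule ccontr)
        assume "\<not> k \<le> g"
        then have "hcoeff Z k = 0" using above[of k] by (auto simp: Z)
        then show False using \<open>k \<in> hsupp Z\<close> by (simp add: hsupp_def)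
      qed
      ultimately show "hcoeff (F Z) h = hcoeff Z h" using FZ by (meson order_trans)
    qed
    moreover have "hcoeff Z g \<noteq> 0" using g(1) above[of g] by (simp add: Z)
    ultimately have "c g = hcoeff Z g" using c by blast
    then show False using Y[of g] above[of g] \<open>hcoeff Z g \<noteq> 0\<close> by simp
  qed
  then show ?thesis by blast
qed

definition hmonom :: "real \<Rightarrow> 'g::linordered_ab_group_add \<Rightarrow> 'g hahn" where
  "hmonom c g = Abs_hahn (\<lambda>h. if h = g then c else 0)"

lemma hcoeff_hmonom: "hcoeff (hmonom c g) h = (if h = g then c else 0)"
  unfolding hmonom_def
  by (rule hcoeff_Abs[of "{g}"]) (auto simp: well_ordered_set_finite split: if_splits)

lemma hcoeff_hmonom_mult: "hcoeff (hmonom c g * x) h = c * hcoeff x (h - g)"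
proof -
  have "hcoeff (hmonom c g * x) h =
    (\<Sum>(a, b)\<in>{(a, b). a \<in> {g} \<and> b \<in> insert (h - g) (hsupp x) \<and> a + b = h}.
      hcoeff (hmonom c g) a * hcoeff x b)"
  proof (rule hcoeff_mult_superset)
    show "well_ordered_set (insert (h - g) (hsupp x))"
      using well_ordered_set_Un[OF well_ordered_set_finite hsupp_well_ordered, of "{h - g}" x] by simp
  qed (auto simp: well_ordered_set_finite hsupp_def hcoeff_hmonom split: if_splits)
  also have "{(a, b). a \<in> {g} \<and> b \<in> insert (h - g) (hsupp x) \<and> a + b = h} = {(g, h - g)}" by auto
  finally show ?thesis by (simp add: hcoeff_hmonom)
qed

lemma hmonom_mult: "hmonom c g * hmonom d h = hmonom (c * d) (g + h)"
  by (rule hahn_eqI) (auto simp: hcoeff_hmonom_mult hcoeff_hmonom)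

lemma hmonom_1: "hmonom 1 0 = 1"
  by (rule hahn_eqI) (simp add: hcoeff_hmonom hcoeff_1)

lemma hahn_leading:
  fixes x :: "'g::linordered_ab_group_add hahn"
  assumes "x \<noteq> 0"
  obtains c g u where "c \<noteq> 0" "x = hmonom c g * (1 + u)" "\<And>h. h \<le> 0 \<Longrightarrow> hcoeff u h = 0"
proof -
  obtain g where g: "hcoeff x g \<noteq> 0" "\<And>h. h < g \<Longrightarrow> hcoeff x h = 0"
    using hahn_first_difference[OF assms] by auto
  define c where "c = hcoeff x g"
  define u where "u = hmonom (inverse c) (- g) * x - 1"
  have c: "c \<noteq> 0" using g(1) c_def by simp
  have u: "hcoeff u h = 0" if "h \<le> 0" for h
    using g that by (auto simp: u_def hcoeff_hmonom_mult c_def hcoeff_1 order_le_less)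
  have "hmonom c g * (1 + u) = (hmonom c g * hmonom (inverse c) (- g)) * x"
    by (simp add: u_def mult.assoc)
  also have "\<dots> = x" using c by (simp add: hmonom_mult hmonom_1)
  finally have "x = hmonom c g * (1 + u)" ..
  from that[OF c this u] show thesis .
qed

lemma hcoeff_mult_cong:
  fixes e x y :: "'g::linordered_ab_group_add hahn"
  assumes e: "\<And>h. h \<le> 0 \<Longrightarrow> hcoeff e h = 0"
    and xy: "\<And>h. h < g \<Longrightarrow> hcoeff x h = hcoeff y h"
  shows "hcoeff (e * x) g = hcoeff (e * y) g"
proof -
  let ?B = "hsupp x \<union> hsupp y"
  have B: "well_ordered_set ?B" by (intro well_ordered_set_Un hsupp_well_ordered)
  let ?S = "{(a, b). a \<in> hsupp e \<and> b \<in> ?B \<and> a + b = g}"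
  have pos: "0 < a" if "a \<in> hsupp e" for a using e[of a] that by (force simp: hsupp_def)
  have "hcoeff (e * x) g = (\<Sum>(a, b)\<in>?S. hcoeff e a * hcoeff x b)"
    by (rule hcoeff_mult_superset[OF hsupp_well_ordered B]) auto
  also have "\<dots> = (\<Sum>(a, b)\<in>?S. hcoeff e a * hcoeff y b)"
    using pos by (intro sum.cong) (auto intro!: xy)
  also have "\<dots> = hcoeff (e * y) g"
    by (rule hcoeff_mult_superset[OF hsupp_well_ordered B, symmetric]) auto
  finally show ?thesis .
qed

lemma hahn_inverse_exists:
  fixes x :: "'g::linordered_ab_group_add hahn"
  assumes "x \<noteq> 0"
  shows "\<exists>y. y * x = 1"
proof -
  obtain c g u where u: "c \<noteq> 0" "x = hmonom c g * (1 + u)" "\<And>h. h \<le> 0 \<Longrightarrow> hcoeff u h = 0"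
    using hahn_leading[OF assms] by blast
  have "\<exists>z. 1 - u * z = z"
  proof (rule hahn_fixed_point)
    fix a b :: "'g hahn" and g assume ab: "\<And>h. h < g \<Longrightarrow> hcoeff a h = hcoeff b h"
    have "hcoeff (u * a) g = hcoeff (u * b) g"
      by (rule hcoeff_mult_cong) (erule u(3), erule ab)
    then show "hcoeff (1 - u * a) g = hcoeff (1 - u * b) g" by simp
  qed
  then obtain z where "1 - u * z = z" by blast
  then have "z + u * z = 1" by (metis diff_add_cancel)
  then have z: "(1 + u) * z = 1" by (simp only: distrib_right mult_1_left)
  have "(hmonom (inverse c) (- g) * z) * x = (hmonom (inverse c) (- g) * hmonom c g) * ((1 + u) * z)"
    unfolding u(2) by (simp only: mult.assoc mult.commute mult.left_commute)
  also have "\<dots> = 1" using u(1) z by (simp add: hmonom_mult hmonom_1)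
  finally show ?thesis by blast
qed

instantiation hahn :: (linordered_ab_group_add) linordered_field
begin

definition inverse_hahn :: "'a hahn \<Rightarrow> 'a hahn" where
  "inverse (x :: 'a hahn) = (if x = 0 then 0 else THE y :: 'a hahn. y * x = 1)"

definition divide_hahn :: "'a hahn \<Rightarrow> 'a hahn \<Rightarrow> 'a hahn" where
  "x div y = x * inverse (y :: 'a hahn)"

instance
proof
  fix x y :: "'a hahn"
  show "inverse x * x = 1" if x: "x \<noteq> 0"
  proof -
    obtain y where y: "y * x = 1" using hahn_inverse_exists[OF x] by blast
    have "z = y" if "z * x = 1" for z
      using mult_cancel_right[of z x y] that y x by simp
    with y have "\<exists>!y. y * x = 1" by blast
    then have "(THE y. y * x = 1) * x = 1" by (rule theI')
    then show ?thesis using x by (simp add: inverse_hahn_def)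
  qed
qed (simp_all add: divide_hahn_def inverse_hahn_def)

end

definition hpos_part :: "'g::linordered_ab_group_add hahn \<Rightarrow> 'g hahn" where
  "hpos_part x = Abs_hahn (\<lambda>h. if 0 < h then hcoeff x h else 0)"

lemma hcoeff_hpos_part: "hcoeff (hpos_part x) h = (if 0 < h then hcoeff x h else 0)"
  unfolding hpos_part_def
  by (rule hcoeff_Abs[OF hsupp_well_ordered[of x]]) (auto simp: hsupp_def split: if_splits)

lemma hahn_sqrt_one_plus:
  fixes u :: "'g::linordered_ab_group_add hahn"
  assumes u: "\<And>h. h \<le> 0 \<Longrightarrow> hcoeff u h = 0"
  shows "\<exists>z. (1 + z) * (1 + z) = 1 + u"
proof -
  define F where "F = (\<lambda>z. hmonom (1/2) 0 * (u - hpos_part z * hpos_part z))"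
  have FI: "hcoeff (F z) g = (hcoeff u g - hcoeff (hpos_part z * hpos_part z) g) / 2" for z g
    by (simp add: F_def hcoeff_hmonom_mult)
  have "\<exists>z. F z = z"
  proof (rule hahn_fixed_point)
    fix a b :: "'g hahn" and g assume "\<And>h. h < g \<Longrightarrow> hcoeff a h = hcoeff b h"
    then have eq: "\<And>h. h < g \<Longrightarrow> hcoeff (hpos_part a) h = hcoeff (hpos_part b) h"
      by (simp add: hcoeff_hpos_part)
    have p: "\<And>h. h \<le> 0 \<Longrightarrow> hcoeff (hpos_part a) h = 0" "\<And>h. h \<le> 0 \<Longrightarrow> hcoeff (hpos_part b) h = 0"
      by (auto simp: hcoeff_hpos_part)
    have "hcoeff (hpos_part a * hpos_part a) g = hcoeff (hpos_part a * hpos_part b) g"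
      by (rule hcoeff_mult_cong[OF p(1) eq])
    also have "\<dots> = hcoeff (hpos_part b * hpos_part a) g" by (simp add: mult.commute)
    also have "\<dots> = hcoeff (hpos_part b * hpos_part b) g"
      by (rule hcoeff_mult_cong[OF p(2) eq])
    finally show "hcoeff (F a) g = hcoeff (F b) g" by (simp add: FI)
  qed
  then obtain z where z: "F z = z" by blast
  have "hcoeff z h = 0" if "h \<le> 0" for h
  proof -
    have "hcoeff (hpos_part z * hpos_part z) h = hcoeff (hpos_part z * 0) h"
      by (rule hcoeff_mult_cong) (use that in \<open>auto simp: hcoeff_hpos_part\<close>)
    then have "hcoeff (F z) h = 0" using u[OF that] by (simp add: FI)
    then show ?thesis using z by simp
  qed
  then have "hpos_part z = z" by (intro hahn_eqI) (simp add: hcoeff_hpos_part)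
  with z FI[of z] have "hcoeff z g = (hcoeff u g - hcoeff (z * z) g) / 2" for g by simp
  then have "hcoeff (z + z + z * z) g = hcoeff u g" for g
    unfolding hcoeff_add by (simp add: field_simps)
  then have "z + z + z * z = u" by (rule hahn_eqI)
  moreover have "(1 + z) * (1 + z) = 1 + (z + z + z * z)" by (simp add: algebra_simps)
  ultimately have "(1 + z) * (1 + z) = 1 + u" by simp
  then show ?thesis by blast
qed

lemma hahn_pos_square:
  fixes x :: "'g::linordered_ab_group_add hahn"
  assumes two_div: "\<forall>g::'g. \<exists>h. h + h = g" and "0 < x"
  shows "\<exists>y. y * y = x"
proof -
  obtain c g u where u: "c \<noteq> 0" "x = hmonom c g * (1 + u)" "\<And>h. h \<le> 0 \<Longrightarrow> hcoeff u h = 0"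
    using hahn_leading[of x] assms(2) by blast
  obtain z where z: "(1 + z) * (1 + z) = 1 + u" using hahn_sqrt_one_plus u(3) by blast
  obtain h where h: "h + h = g" using two_div by blast
  have x: "hcoeff x k = c * (hcoeff 1 (k - g) + hcoeff u (k - g))" for k
    by (simp add: u(2) hcoeff_hmonom_mult)
  obtain k where k: "0 < hcoeff x k" "\<And>h. h < k \<Longrightarrow> hcoeff x h = 0"
    using assms(2) hahn_pos_iff by blast
  have "k = g"
  proof (cases k g rule: linorder_cases)
    case less
    then show ?thesis using k(1) u(3)[of "k - g"] by (auto simp: x hcoeff_1 split: if_splits)
  next
    case greater
    then show ?thesis using k(2)[of g] u(1) u(3)[of 0] by (simp add: x hcoeff_1)
  qed
  then have "0 < c" using k(1) u(3)[of 0] by (simp add: x hcoeff_1)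
  have "(hmonom (sqrt c) h * (1 + z)) * (hmonom (sqrt c) h * (1 + z))
      = (hmonom (sqrt c) h * hmonom (sqrt c) h) * ((1 + z) * (1 + z))" by (simp only: ac_simps)
  also have "\<dots> = x" using \<open>0 < c\<close> by (simp add: hmonom_mult h z u(2))
  finally show ?thesis by blast
qed

theorem hahn_order_unique:
  fixes P :: "'g::linordered_ab_group_add hahn set"
  assumes divisible: "\<forall>n::nat. n > 0 \<longrightarrow> (\<forall>g::'g. \<exists>h. (\<Sum>i<n. h) = g)"
    and add: "\<And>x y. x \<in> P \<Longrightarrow> y \<in> P \<Longrightarrow> x + y \<in> P"
    and mult: "\<And>x y. x \<in> P \<Longrightarrow> y \<in> P \<Longrightarrow> x * y \<in> P"
    and zero: "0 \<notin> P"
    and total: "\<And>x. x \<noteq> 0 \<Longrightarrow> x \<in> P \<or> - x \<in> P"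
  shows "P = {x. 0 < x}"
proof -
  have two_div: "\<forall>g::'g. \<exists>h. h + h = g"
    using divisible[rule_format, of "Suc (Suc 0)"] by (simp add: lessThan_Suc)
  have pos: "x \<in> P" if x: "0 < x" for x
  proof -
    obtain y where y: "y * y = x" using hahn_pos_square[OF two_div x] by blast
    then have "y \<noteq> 0" using x by auto
    then have "y \<in> P \<or> - y \<in> P" using total by blast
    then show ?thesis using mult[of y y] mult[of "- y" "- y"] y by auto
  qed
  moreover have "0 < x" if "x \<in> P" for x
  proof (rule ccontr)
    assume "\<not> 0 < x"
    moreover have "x \<noteq> 0" using that zero by blast
    ultimately have "- x \<in> P" using pos by simp
    then show False using add[OF that, of "- x"] zero by simp
  qed
  ultimately show ?thesis by blast
qed

definition is_logarithm :: "('a::linordered_field \<Rightarrow> 'a) \<Rightarrow> bool" where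
  "is_logarithm L \<longleftrightarrow>
     (\<forall>x\<in>{0<..}. \<forall>y\<in>{0<..}. L (x * y) = L x + L y) \<and>
     strict_mono_on {0<..} L \<and>
     inj_on L {0<..}"

end

theory Submission
  imports Defs
begin

text \<open>
  A logarithm is an embedding of the ordered group \<open>K\<^sup>+\<close> of positive elements into the
  additive group of the power series field \<open>K\<close>.  By Hahn's embedding theorem any ordered abelian group \<open>A\<close> embeds into a
  group of power series, provided that the exponents label the archimedean classes of \<open>A\<close> in
  the right order.  The group \<open>A = K\<^sup>+\<close> can be labelled by exponents from \<open>G\<close> itself, as follows.

  Let \<open>x > 1\<close> and let \<open>v\<close> be the valuation of \<open>x - 1\<close>.  If \<open>v \<ge> 0\<close>, then \<open>x\<close> is bounded by a
  natural number, \<open>x ^ n - 1\<close> is of the same size as \<open>x - 1\<close>, and \<open>v\<close> itself labels the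
  multiplicative archimedean class of \<open>x\<close>.  If \<open>v < 0\<close>, then \<open>x\<close> is infinite with valuation
  \<open>v\<close>, and its class is determined by the archimedean class of \<open>- v\<close> in \<open>G\<close>; a fixed positive
  representative \<open>e\<close> of that class provides the label \<open>- e\<close>.  Lemma
  \<open>log_exponent_le_iff\<close> shows that these labels are ordered as Hahn's theorem demands.

  The resulting logarithm only takes values whose support consists of labels.  Negative labels
  are negatives of chosen representatives, of which there is only one in each archimedean
  class.  As \<open>e\<close> and \<open>e + e\<close> lie in the same class, the exponent \<open>- (e + e)\<close> never occurs, so
  the monomial with this exponent has no preimage.

  The embedding theorem \<open>hahn_embedding\<close> is proved by an idea of Banaschewski.  For each label a
  real functional is needed that extends the order preserving functional on the convex
  subgroup of the class, and the values of these functionals at a fixed element must have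
  well ordered support.  Both follow if the functionals are extended by zero along complements
  that shrink when the subgroup grows (\<open>complement_antimono\<close>); such complements are
  spanned by the elements that a greedy run through a well-order of \<open>A\<close> would add to the subgroup.
\<close>

section \<open>Integer multiples and pure hulls\<close>

primrec nat_multiple :: "nat \<Rightarrow> 'a::ab_group_add \<Rightarrow> 'a" where
  "nat_multiple 0 x = 0"
| "nat_multiple (Suc n) x = x + nat_multiple n x"

text \<open>Every abelian group is a module over the integers; its subspaces are the subgroups and
  spans are generated subgroups.\<close>

definition int_multiple :: "int \<Rightarrow> 'a::ab_group_add \<Rightarrow> 'a" (infixr "\<cdot>" 75) where
  "k \<cdot> x = nat_multiple (nat k) x - nat_multiple (nat (- k)) x"

lemma nat_multiple_add: "nat_multiple (m + n) x = nat_multiple m x + nat_multiple n x"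
  by (induction m) (simp_all add: add.assoc)

lemma nat_multiple_distrib: "nat_multiple n (x + y) = nat_multiple n x + nat_multiple n y"
  by (induction n) (simp_all add: algebra_simps)

lemma nat_multiple_mult: "nat_multiple (m * n) x = nat_multiple m (nat_multiple n x)"
  by (induction m) (simp_all add: nat_multiple_add)

lemma int_multiple_diff: "(int p - int q) \<cdot> x = nat_multiple p x - nat_multiple q x"
proof -
  have "nat (int p - int q) + q = nat (- (int p - int q)) + p" by auto
  then have "nat_multiple (nat (int p - int q)) x + nat_multiple q x
      = nat_multiple (nat (- (int p - int q))) x + nat_multiple p x"
    by (metis nat_multiple_add)
  then show ?thesis by (simp add: int_multiple_def algebra_simps)
qed

lemma int_multiple_of_nat: "int n \<cdot> x = nat_multiple n x"
  using int_multiple_diff[of n 0 x] by simp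

lemma int_multiple_minus: "(- k) \<cdot> x = - (k \<cdot> x)"
  by (simp add: int_multiple_def)

interpretation int_module: module int_multiple
proof
  fix a b :: int and x y :: 'a
  obtain p q where a: "a = int p - int q" by (metis int_diff_cases)
  obtain r s where b: "b = int r - int s" by (metis int_diff_cases)
  show "a \<cdot> (x + y) = a \<cdot> x + a \<cdot> y"
    by (simp add: a int_multiple_diff nat_multiple_distrib)
  show "(a + b) \<cdot> x = a \<cdot> x + b \<cdot> x"
  proof -
    have "a + b = int (p + r) - int (q + s)" by (simp add: a b)
    then show ?thesis by (simp only: int_multiple_diff a b nat_multiple_add) simp
  qed
  show "1 \<cdot> x = x" by (simp add: int_multiple_def)
  show "a \<cdot> b \<cdot> x = (a * b) \<cdot> x"
  proof -
    have neg: "nat_multiple n (u - v) = nat_multiple n u - nat_multiple n v" for n and u v :: 'a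
      using nat_multiple_distrib[of n "u - v" v] by simp
    have "a * b = int (p * r + q * s) - int (p * s + q * r)" by (simp add: a b algebra_simps)
    then show ?thesis
      by (simp only: int_multiple_diff a b nat_multiple_add nat_multiple_mult neg) simp
  qed
qed

lemma int_multiple_pos:
  fixes x :: "'a::linordered_ab_group_add"
  assumes "0 < k" "0 < x"
  shows "0 < k \<cdot> x"
proof -
  have "0 < nat_multiple (Suc n) x" for n
    by (induction n) (use assms(2) in \<open>simp_all add: add_pos_pos\<close>)
  then show ?thesis
    using assms(1) int_multiple_of_nat[of "nat k" x]
    by (metis gr0_implies_Suc nat_0_le order_less_imp_le zero_less_nat_eq)
qed

lemma int_multiple_le_iff_left:
  fixes x :: "'a::linordered_ab_group_add"
  assumes "0 < x"
  shows "k \<cdot> x \<le> l \<cdot> x \<longleftrightarrow> k \<le> l"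
  using int_multiple_pos[of "l - k" x] int_multiple_pos[of "k - l" x] assms
  by (cases k l rule: linorder_cases) (auto simp: int_module.scale_left_diff_distrib)

lemma int_multiple_mono_right:
  fixes x y :: "'a::linordered_ab_group_add"
  assumes "0 \<le> k" "x \<le> y"
  shows "k \<cdot> x \<le> k \<cdot> y"
  using int_multiple_pos[of k "y - x"] assms
  by (cases "k = 0"; cases "x = y") (auto simp: int_module.scale_right_diff_distrib less_imp_le)

text \<open>The elements that depend on \<open>S\<close> over the rationals: in a torsion free group, those in the
  rational span of \<open>S\<close> inside the divisible hull.\<close>

definition pure_hull :: "'a::ab_group_add set \<Rightarrow> 'a set" where
  "pure_hull S = {x. \<exists>k>0. k \<cdot> x \<in> int_module.span S}"

lemma subspace_pure_hull: "int_module.subspace (pure_hull S)"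
proof (rule int_module.subspaceI)
  show "0 \<in> pure_hull S"
    by (auto simp: pure_hull_def int_module.span_zero intro: exI[of _ 1])
next
  fix x y assume "x \<in> pure_hull S" "y \<in> pure_hull S"
  then obtain k l where kl: "0 < k" "0 < l" "k \<cdot> x \<in> int_module.span S" "l \<cdot> y \<in> int_module.span S"
    by (auto simp: pure_hull_def)
  have "(k * l) \<cdot> (x + y) = l \<cdot> k \<cdot> x + k \<cdot> l \<cdot> y"
    by (simp add: int_module.scale_right_distrib mult.commute)
  also have "\<dots> \<in> int_module.span S"
    by (intro int_module.span_add int_module.span_scale kl)
  finally show "x + y \<in> pure_hull S" using kl(1,2) unfolding pure_hull_def by (metis (mono_tags) mem_Collect_eq mult_pos_pos)
next
  fix c x assume "x \<in> pure_hull S"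
  then obtain k where k: "0 < k" "k \<cdot> x \<in> int_module.span S" by (auto simp: pure_hull_def)
  have "k \<cdot> c \<cdot> x = c \<cdot> k \<cdot> x" by (simp add: mult.commute)
  then show "c \<cdot> x \<in> pure_hull S"
    using k int_module.span_scale[OF k(2), of c] by (auto simp: pure_hull_def intro!: exI[of _ k])
qed

lemma pure_hull_superset: "S \<subseteq> pure_hull S"
  by (auto simp: pure_hull_def int_module.span_base intro: exI[of _ 1])

lemma pure_hull_mono: "S \<subseteq> T \<Longrightarrow> pure_hull S \<subseteq> pure_hull T"
  using int_module.span_mono[of S T] by (auto simp: pure_hull_def)

lemma pure_hull_minimal: "S \<subseteq> pure_hull T \<Longrightarrow> pure_hull S \<subseteq> pure_hull T"
proof
  fix x assume S: "S \<subseteq> pure_hull T" and "x \<in> pure_hull S"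
  then obtain k where k: "0 < k" "k \<cdot> x \<in> int_module.span S" by (auto simp: pure_hull_def)
  have "int_module.span S \<subseteq> pure_hull T"
    by (rule int_module.span_minimal[OF S subspace_pure_hull])
  then obtain l where "0 < l" "l \<cdot> k \<cdot> x \<in> int_module.span T" using k by (auto simp: pure_hull_def)
  then show "x \<in> pure_hull T" using k(1) by (auto simp: pure_hull_def intro!: exI[of _ "l * k"])
qed

lemma pure_hull_cancel:
  assumes "k \<noteq> 0" "k \<cdot> x \<in> int_module.span S"
  shows "x \<in> pure_hull S"
proof -
  have "\<bar>k\<bar> \<cdot> x \<in> int_module.span S"
    using assms(2) int_module.span_neg[OF assms(2)] by (cases "0 \<le> k") (auto simp: int_multiple_minus)
  then show ?thesis using assms(1) by (auto simp: pure_hull_def intro!: exI[of _ "\<bar>k\<bar>"])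
qed

section \<open>Monotone choice of complements\<close>

definition some_well_order :: "'a rel" where
  "some_well_order = (SOME R. wf R \<and> trans R \<and> total R)"

lemma some_well_order: "wf (some_well_order :: 'a rel)" "trans (some_well_order :: 'a rel)" "total (some_well_order :: 'a rel)"
proof -
  obtain r :: "'a rel" where r: "Well_order r" "Field r = UNIV"
    using well_ordering[where 'a = 'a] by (elim exE conjE)
  then have "wf (r - Id)" "trans r" "antisym r" "total r"
    unfolding well_order_on_def linear_order_on_def partial_order_on_def preorder_on_def by simp_all
  then have "wf (r - Id) \<and> trans (r - Id) \<and> total (r - Id)"
    by (simp add: trans_diff_Id)
  then have "\<exists>R::'a rel. wf R \<and> trans R \<and> total R" by (rule exI)
  from someI_ex[OF this, folded some_well_order_def]
  show "wf (some_well_order::'a rel)" "trans (some_well_order::'a rel)" "total (some_well_order::'a rel)" by simp_all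
qed

text \<open>An element is selected if it depends neither on \<open>C\<close> nor on what precedes it in the
  well-order.  A larger \<open>C\<close> leads to a smaller selection, which would fail for complements chosen
  independently for each \<open>C\<close>.\<close>

definition greedy_basis :: "'a::ab_group_add set \<Rightarrow> 'a set" where
  "greedy_basis C = {b. b \<notin> pure_hull (C \<union> {a. (a, b) \<in> some_well_order})}"

definition complement :: "'a::ab_group_add set \<Rightarrow> 'a set" where
  "complement C = int_module.span (greedy_basis C)"

lemma complement_antimono: "C \<subseteq> D \<Longrightarrow> complement D \<subseteq> complement C"
  unfolding complement_def greedy_basis_def
proof (intro int_module.span_mono subsetI CollectI notI)
  fix b
  assume CD: "C \<subseteq> D" and b: "b \<in> {b. b \<notin> pure_hull (D \<union> {a. (a, b) \<in> some_well_order})}"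
    and "b \<in> pure_hull (C \<union> {a. (a, b) \<in> some_well_order})"
  then have "b \<in> pure_hull (D \<union> {a. (a, b) \<in> some_well_order})"
    using pure_hull_mono[OF Un_mono[OF CD order_refl]] by blast
  then show False using b by simp
qed

text \<open>By induction along the well-order each element depends on \<open>C\<close> and the selected elements:
  an element that is not selected depends on \<open>C\<close> and its predecessors.  Dependence is rational, so only
  a multiple of \<open>x\<close> decomposes.\<close>

lemma complement_decomp:
  assumes C: "int_module.subspace C"
  obtains k c d where "0 < k" "k \<cdot> x = c + d" "c \<in> C" "d \<in> complement C"
proof -
  let ?H = "pure_hull (C \<union> greedy_basis C)"
  have all: "b \<in> ?H" for b
    using some_well_order(1)
  proof (induction b rule: wf_induct_rule)
    case (less b)
    then have smaller: "{a. (a, b) \<in> some_well_order} \<subseteq> ?H" by blast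
    show ?case
    proof (cases "b \<in> greedy_basis C")
      case True
      then show ?thesis using pure_hull_superset by blast
    next
      case False
      then have "b \<in> pure_hull (C \<union> {a. (a, b) \<in> some_well_order})" by (simp add: greedy_basis_def)
      moreover have "C \<union> {a. (a, b) \<in> some_well_order} \<subseteq> ?H"
        using smaller pure_hull_superset[of "C \<union> greedy_basis C"] by simp
      ultimately show ?thesis using pure_hull_minimal[of _ "C \<union> greedy_basis C"] by blast
    qed
  qed
  obtain k where k: "0 < k" "k \<cdot> x \<in> int_module.span (C \<union> greedy_basis C)"
    using all[of x] unfolding pure_hull_def mem_Collect_eq by (elim exE conjE)
  then obtain c d where cd: "k \<cdot> x = c + d" "c \<in> int_module.span C"
      "d \<in> int_module.span (greedy_basis C)"
    unfolding int_module.span_Un mem_Collect_eq by (elim exE conjE)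
  have "c \<in> C" using cd(2) int_module.span_eq_iff[THEN iffD2, OF C] by simp
  then show thesis
    using that[OF k(1) cd(1)] cd(3) unfolding complement_def by blast
qed

text \<open>In a nontrivial combination of selected elements that lies in \<open>C\<close>, the last element
  depends on \<open>C\<close> and its predecessors, so it would not have been selected.\<close>

lemma complement_disjoint:
  assumes C: "int_module.subspace C" and d: "d \<in> C" "d \<in> complement C"
  shows "d = 0"
proof -
  obtain t r where t: "finite t" "t \<subseteq> greedy_basis C" "d = (\<Sum>b\<in>t. r b \<cdot> b)"
    using d(2) unfolding complement_def int_module.span_explicit by blast
  define s where "s = {b\<in>t. r b \<noteq> 0}"
  have s: "finite s" "s \<subseteq> greedy_basis C" "\<And>b. b \<in> s \<Longrightarrow> r b \<noteq> 0" using t by (auto simp: s_def)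
  have ds: "d = (\<Sum>b\<in>s. r b \<cdot> b)"
    unfolding t(3) by (rule sum.mono_neutral_right) (use t(1) in \<open>auto simp: s_def\<close>)
  have "s = {}"
  proof (rule ccontr)
    assume "s \<noteq> {}"
    \<comment> \<open>The last element of \<open>s\<close> exists because a finite acyclic relation has a well-founded
      converse.\<close>
    have "acyclic (some_well_order \<inter> s \<times> s)" by (rule wf_acyclic) (rule wf_subset[OF some_well_order(1)], blast)
    then have "wf ((some_well_order \<inter> s \<times> s)\<inverse>)" using s(1) by (intro finite_acyclic_wf_converse) auto
    then obtain m where m: "m \<in> s" "\<And>b. b \<in> s \<Longrightarrow> (m, b) \<notin> some_well_order"
      using \<open>s \<noteq> {}\<close> by (elim wfE_min') auto
    let ?S = "C \<union> {a. (a, m) \<in> some_well_order}"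
    have "b \<in> ?S" if "b \<in> s - {m}" for b
      using m(2)[of b] that some_well_order(3) by (auto simp: total_on_def)
    then have "(\<Sum>b\<in>s - {m}. r b \<cdot> b) \<in> int_module.span ?S"
      by (intro int_module.span_sum int_module.span_scale int_module.span_base)
    moreover have "d \<in> int_module.span ?S" using d(1) by (simp add: int_module.span_base)
    ultimately have "d - (\<Sum>b\<in>s - {m}. r b \<cdot> b) \<in> int_module.span ?S"
      by (intro int_module.span_diff)
    also have "d - (\<Sum>b\<in>s - {m}. r b \<cdot> b) = r m \<cdot> m"
      using s(1) m(1) by (simp add: ds sum.remove)
    finally have "m \<in> pure_hull ?S" using s(3)[OF m(1)] by (rule pure_hull_cancel[rotated])
    then show False using m(1) s(2) by (auto simp: greedy_basis_def)
  qed
  then show ?thesis by (simp add: ds)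
qed

section \<open>Convex subgroups and real ratios\<close>

text \<open>For \<open>e > 0\<close> this is the least convex subgroup containing \<open>e\<close>; two positive elements are
  archimedean equivalent iff their convex spans agree.\<close>

definition convex_span :: "'a::linordered_ab_group_add \<Rightarrow> 'a set" where
  "convex_span e = {x. \<exists>k. - (k \<cdot> e) \<le> x \<and> x \<le> k \<cdot> e}"

lemma subspace_convex_span:
  assumes e: "0 < e"
  shows "int_module.subspace (convex_span e)"
proof (rule int_module.subspaceI)
  show "0 \<in> convex_span e" by (auto simp: convex_span_def intro!: exI[of _ 0])
next
  fix x y assume "x \<in> convex_span e" "y \<in> convex_span e"
  then obtain k l where "- (k \<cdot> e) \<le> x" "x \<le> k \<cdot> e" "- (l \<cdot> e) \<le> y" "y \<le> l \<cdot> e"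
    by (auto simp: convex_span_def)
  then have "- ((k + l) \<cdot> e) \<le> x + y" "x + y \<le> (k + l) \<cdot> e"
    using add_mono[of "- (k \<cdot> e)" x "- (l \<cdot> e)" y] add_mono[of x "k \<cdot> e" y "l \<cdot> e"]
    by (auto simp: int_module.scale_left_distrib algebra_simps)
  then show "x + y \<in> convex_span e" by (auto simp: convex_span_def)
next
  fix c x assume "x \<in> convex_span e"
  then obtain k where k: "- (k \<cdot> e) \<le> x" "x \<le> k \<cdot> e" by (auto simp: convex_span_def)
  then have "\<bar>c\<bar> \<cdot> - (k \<cdot> e) \<le> \<bar>c\<bar> \<cdot> x" "\<bar>c\<bar> \<cdot> x \<le> \<bar>c\<bar> \<cdot> k \<cdot> e"
    by (intro int_multiple_mono_right; simp)+
  then have "- ((\<bar>c\<bar> * k) \<cdot> e) \<le> c \<cdot> x \<and> c \<cdot> x \<le> (\<bar>c\<bar> * k) \<cdot> e"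
    by (cases "0 \<le> c") (auto simp: int_multiple_minus minus_le_iff le_minus_iff)
  then show "c \<cdot> x \<in> convex_span e" by (auto simp: convex_span_def)
qed

lemma convex_span_self: "0 < e \<Longrightarrow> e \<in> convex_span e"
  by (auto simp: convex_span_def intro!: exI[of _ 1] order_trans[of "-e" 0 e])

lemma convex_span_pos_iff:
  assumes "0 < e" "0 < x"
  shows "x \<in> convex_span e \<longleftrightarrow> (\<exists>n. x \<le> nat_multiple n e)"
proof
  assume "x \<in> convex_span e"
  then obtain k where "x \<le> k \<cdot> e" by (auto simp: convex_span_def)
  also have "\<dots> \<le> int (nat k) \<cdot> e" using assms(1) by (simp add: int_multiple_le_iff_left)
  finally show "\<exists>n. x \<le> nat_multiple n e" unfolding int_multiple_of_nat by blast
next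
  assume "\<exists>n. x \<le> nat_multiple n e"
  then obtain n where n: "x \<le> int n \<cdot> e" unfolding int_multiple_of_nat by blast
  then have "- (int n \<cdot> e) \<le> x" using assms(2) by (meson less_imp_le neg_le_0_iff_le order_trans)
  then show "x \<in> convex_span e" using n by (auto simp: convex_span_def)
qed

lemma convex_span_between:
  assumes "a \<in> convex_span e" "- a \<le> x" "x \<le> a"
  shows "x \<in> convex_span e"
proof -
  obtain k where "a \<le> k \<cdot> e" using assms(1) by (auto simp: convex_span_def)
  then show ?thesis using assms(2,3) unfolding convex_span_def
    by (auto intro!: exI[of _ k] intro: order_trans[of _ "- a" x])
qed

lemma convex_span_subset_iff:
  assumes "0 < a" "0 < b"
  shows "convex_span a \<subseteq> convex_span b \<longleftrightarrow> a \<in> convex_span b"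
proof
  assume ab: "a \<in> convex_span b"
  have "k \<cdot> a \<in> convex_span b" for k
    by (rule int_module.subspace_scale[OF subspace_convex_span[OF assms(2)] ab])
  then show "convex_span a \<subseteq> convex_span b"
    using convex_span_between unfolding convex_span_def[of a] by blast
qed (use convex_span_self[OF assms(1)] in blast)

lemma infinitely_larger:
  assumes "0 < a" "0 < b" "b \<notin> convex_span a"
  shows "k \<cdot> a < b"
  using convex_span_pos_iff[OF assms(1,2)] assms(3) int_multiple_le_iff_left[OF assms(1), of k "int (nat k)"]
  unfolding int_multiple_of_nat by (metis le_nat_iff linorder_not_le nat_int nat_le_iff order_refl order_trans)

text \<open>The Dedekind cut of \<open>x / e\<close>.  On \<open>convex_span e\<close> it is the order preserving homomorphism
  to the reals of Hoelder's theorem, normalised to be 1 at \<open>e\<close>.\<close>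

definition ratio :: "'a::linordered_ab_group_add \<Rightarrow> 'a \<Rightarrow> real" where
  "ratio e x = Sup {of_int m / of_int n |m n. 0 < n \<and> m \<cdot> e \<le> n \<cdot> x}"

lemma ratio_cut:
  fixes e :: "'a::linordered_ab_group_add"
  assumes e: "0 < e" and n: "0 < n" "m \<cdot> e \<le> n \<cdot> x" and l: "0 < l" "l \<cdot> x \<le> k \<cdot> e"
  shows "real_of_int m / of_int n \<le> of_int k / of_int l"
proof -
  have "(l * m) \<cdot> e \<le> l \<cdot> n \<cdot> x"
    using int_multiple_mono_right[of l, OF _ n(2)] l(1) by simp
  also have "\<dots> = n \<cdot> l \<cdot> x" by (simp add: mult.commute)
  also have "\<dots> \<le> n \<cdot> k \<cdot> e"
    using int_multiple_mono_right[of n, OF _ l(2)] n(1) by simp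
  finally have "l * m \<le> n * k" using int_multiple_le_iff_left[OF e] by simp
  then have "real_of_int l * of_int m \<le> of_int n * of_int k"
    unfolding of_int_mult[symmetric] of_int_le_iff .
  then show ?thesis using n(1) l(1) by (simp add: field_simps)
qed

lemma ratio_bounds:
  assumes e: "0 < e" and x: "x \<in> convex_span e" and n: "0 < n"
  shows "m \<cdot> e \<le> n \<cdot> x \<Longrightarrow> of_int m / of_int n \<le> ratio e x"
    and "n \<cdot> x \<le> m \<cdot> e \<Longrightarrow> ratio e x \<le> of_int m / of_int n"
proof -
  let ?S = "{real_of_int m / of_int n |m n. 0 < n \<and> m \<cdot> e \<le> n \<cdot> x}"
  obtain k where k: "- (k \<cdot> e) \<le> x" "x \<le> k \<cdot> e" using x by (auto simp: convex_span_def)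
  have "bdd_above ?S"
    by (rule bdd_aboveI[of _ "of_int k / of_int 1"]) (use ratio_cut[OF e, of _ _ x 1 k] k in auto)
  then show "m \<cdot> e \<le> n \<cdot> x \<Longrightarrow> of_int m / of_int n \<le> ratio e x"
    unfolding ratio_def using n by (intro cSup_upper) auto
  have "0 < (1::int) \<and> (- k) \<cdot> e \<le> 1 \<cdot> x" using k by (simp add: int_multiple_minus)
  then have "?S \<noteq> {}" by blast
  then show "n \<cdot> x \<le> m \<cdot> e \<Longrightarrow> ratio e x \<le> of_int m / of_int n"
    unfolding ratio_def using n ratio_cut[OF e] by (intro cSup_least) auto
qed

lemma int_part_exists:
  assumes e: "0 < e" and x: "x \<in> convex_span e"
  obtains m where "m \<cdot> e \<le> x" "x \<le> (m + 1) \<cdot> e"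
proof -
  obtain k where k: "- (k \<cdot> e) \<le> x" "x \<le> k \<cdot> e" using x by (auto simp: convex_span_def)
  have "\<exists>m. m \<cdot> e \<le> x \<and> x \<le> (m + 1) \<cdot> e"
  proof (rule ccontr)
    assume none: "\<not> ?thesis"
    have "(- k + int n) \<cdot> e \<le> x" for n
    proof (induction n)
      case 0
      then show ?case using k(1) by (simp add: int_multiple_minus)
    next
      case (Suc n)
      then have "\<not> x \<le> (- k + int n + 1) \<cdot> e" using none by blast
      then show ?case by (simp add: add.commute add.left_commute)
    qed
    from this[of "nat (2 * k + 1)"] have "(- k + int (nat (2 * k + 1))) \<cdot> e \<le> k \<cdot> e"
      using k(2) by (rule order_trans)
    then have "- k + int (nat (2 * k + 1)) \<le> k" by (simp add: int_multiple_le_iff_left[OF e])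
    then show False by linarith
  qed
  then show thesis using that by blast
qed

text \<open>Integer approximations of \<open>n \<cdot> x\<close> and \<open>n \<cdot> y\<close> from below by multiples of \<open>e\<close> are wrong by
  at most one multiple each.  Hence the two sides differ by at most \<open>2 / n\<close> for all \<open>n\<close>.\<close>

lemma ratio_add:
  assumes e: "0 < e" and x: "x \<in> convex_span e" and y: "y \<in> convex_span e"
  shows "ratio e (x + y) = ratio e x + ratio e y"
proof -
  let ?\<delta> = "\<bar>ratio e (x + y) - (ratio e x + ratio e y)\<bar>"
  have xy: "x + y \<in> convex_span e"
    by (rule int_module.subspace_add[OF subspace_convex_span[OF e] x y])
  have small: "?\<delta> \<le> 2 / real (Suc N)" for N
  proof -
    define n where "n = int (Suc N)"
    have n: "0 < n" by (simp add: n_def)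
    have mult: "n \<cdot> z \<in> convex_span e" if "z \<in> convex_span e" for z
      by (rule int_module.subspace_scale[OF subspace_convex_span[OF e] that])
    obtain p where p: "p \<cdot> e \<le> n \<cdot> x" "n \<cdot> x \<le> (p + 1) \<cdot> e" using int_part_exists[OF e mult[OF x]] .
    obtain q where q: "q \<cdot> e \<le> n \<cdot> y" "n \<cdot> y \<le> (q + 1) \<cdot> e" using int_part_exists[OF e mult[OF y]] .
    have pq: "(p + q) \<cdot> e \<le> n \<cdot> (x + y)" "n \<cdot> (x + y) \<le> ((p + 1) + (q + 1)) \<cdot> e"
      unfolding int_module.scale_left_distrib[of p q] int_module.scale_left_distrib[of "p + 1" "q + 1"]
        int_module.scale_right_distrib by (intro add_mono p q)+
    have "of_int (p + q) / of_int n \<le> ratio e (x + y)"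
      "ratio e (x + y) \<le> of_int ((p + 1) + (q + 1)) / of_int n"
      by (intro ratio_bounds[OF e xy n] pq)+
    moreover have "of_int p / of_int n \<le> ratio e x" "ratio e x \<le> of_int (p + 1) / of_int n"
      by (intro ratio_bounds[OF e x n] p)+
    moreover have "of_int q / of_int n \<le> ratio e y" "ratio e y \<le> of_int (q + 1) / of_int n"
      by (intro ratio_bounds[OF e y n] q)+
    ultimately have "?\<delta> \<le> 2 / of_int n" by (simp add: add_divide_distrib abs_le_iff)
    then show ?thesis by (simp add: n_def)
  qed
  have "?\<delta> \<le> 0"
  proof (rule ccontr)
    assume "\<not> ?\<delta> \<le> 0"
    then have "0 < ?\<delta> / 2" by simp
    then obtain N where "inverse (real (Suc N)) < ?\<delta> / 2" using reals_Archimedean by blast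
    then show False using small[of N] by (simp add: field_simps)
  qed
  then show ?thesis by simp
qed

lemma ratio_zero: "0 < e \<Longrightarrow> ratio e 0 = 0"
  using ratio_add[of e 0 0] int_module.subspace_0[OF subspace_convex_span] by auto

lemma ratio_multiple:
  assumes e: "0 < e" and x: "x \<in> convex_span e" and k: "0 < k"
  shows "ratio e (k \<cdot> x) = of_int k * ratio e x"
proof -
  have nx: "nat_multiple n x \<in> convex_span e" for n
    using int_module.subspace_scale[OF subspace_convex_span[OF e] x, of "int n"] by (simp add: int_multiple_of_nat)
  have "ratio e (nat_multiple n x) = real n * ratio e x" for n
    by (induction n) (simp_all add: ratio_zero e ratio_add[OF e x nx] algebra_simps)
  from this[of "nat k"] show ?thesis using k int_multiple_of_nat[of "nat k" x] by simp
qed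

lemma ratio_infinitesimal:
  assumes e: "0 < e" "0 < e'" and x: "x \<in> convex_span e" and e': "e' \<notin> convex_span e"
  shows "x \<in> convex_span e'" and "ratio e' x = 0"
proof -
  obtain k where k: "- (k \<cdot> e) \<le> x" "x \<le> k \<cdot> e" using x by (auto simp: convex_span_def)
  have bounds: "n \<cdot> x \<le> 1 \<cdot> e'" "(- 1) \<cdot> e' \<le> n \<cdot> x" if n: "0 < n" for n
  proof -
    have "n \<cdot> x \<le> n \<cdot> k \<cdot> e" "- (n \<cdot> k \<cdot> e) \<le> n \<cdot> x"
      using int_multiple_mono_right[OF less_imp_le[OF n] k(2)]
        int_multiple_mono_right[OF less_imp_le[OF n] k(1)] by simp_all
    moreover have "n \<cdot> k \<cdot> e < e'" using infinitely_larger[OF e e', of "n * k"] by simp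
    moreover have "- e' < - (n \<cdot> k \<cdot> e)" using calculation(3) by simp
    ultimately have "n \<cdot> x \<le> e'" "- e' \<le> n \<cdot> x" by order+
    then show "n \<cdot> x \<le> 1 \<cdot> e'" "(- 1) \<cdot> e' \<le> n \<cdot> x" by (simp_all add: int_multiple_minus)
  qed
  show xe': "x \<in> convex_span e'"
    using bounds[of 1] unfolding convex_span_def mem_Collect_eq
    by (intro exI[of _ 1]) (simp add: int_multiple_minus)
  have small: "\<bar>ratio e' x\<bar> \<le> inverse (real (Suc N))" for N
  proof -
    have pos: "0 < int (Suc N)" by simp
    note ratio_bounds[OF e(2) xe' pos]
    from this(1)[OF bounds(2)[OF pos]] this(2)[OF bounds(1)[OF pos]]
    show ?thesis by (simp add: abs_le_iff inverse_eq_divide minus_le_iff)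
  qed
  show "ratio e' x = 0"
  proof (rule ccontr)
    assume "ratio e' x \<noteq> 0"
    then have "0 < \<bar>ratio e' x\<bar>" by simp
    then obtain N where "inverse (real (Suc N)) < \<bar>ratio e' x\<bar>"
      using reals_Archimedean by blast
    then show False using small[of N] by linarith
  qed
qed

lemma ratio_pos:
  assumes "0 < e" "0 < x" "x \<in> convex_span e" "e \<in> convex_span x"
  shows "0 < ratio e x"
proof -
  obtain n where "e \<le> nat_multiple n x" using convex_span_pos_iff[of x e] assms by blast
  then have n: "1 \<cdot> e \<le> int n \<cdot> x" by (simp add: int_multiple_of_nat)
  have "n \<noteq> 0" using n assms(1) by (intro notI) simp
  then have pos: "0 < int n" by simp
  have "0 < real_of_int 1 / of_int (int n)" using pos by simp
  also have "\<dots> \<le> ratio e x" by (rule ratio_bounds(1)[OF assms(1,3) pos n])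
  finally show ?thesis .
qed

text \<open>The extension of the ratio functional from \<open>convex_span e\<close> to the whole group that vanishes
  on the chosen complement.  In general only a multiple of \<open>x\<close> decomposes, so the value is
  divided by the factor.\<close>

definition coefficient :: "'a::linordered_ab_group_add \<Rightarrow> 'a \<Rightarrow> real" where
  "coefficient e x = (THE r. \<exists>k c d. 0 < k \<and> k \<cdot> x = c + d \<and> c \<in> convex_span e \<and>
     d \<in> complement (convex_span e) \<and> r = ratio e c / of_int k)"

lemma coefficient_eq:
  assumes e: "0 < e" and k: "0 < k" "k \<cdot> x = c + d"
    and c: "c \<in> convex_span e" and d: "d \<in> complement (convex_span e)"
  shows "coefficient e x = ratio e c / of_int k"
  unfolding coefficient_def
proof (rule the_equality)
  show "\<exists>k' c' d'. 0 < k' \<and> k' \<cdot> x = c' + d' \<and> c' \<in> convex_span e \<and>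
      d' \<in> complement (convex_span e) \<and> ratio e c / of_int k = ratio e c' / of_int k'"
    using assms by blast
next
  fix r assume "\<exists>k c d. 0 < k \<and> k \<cdot> x = c + d \<and> c \<in> convex_span e \<and>
      d \<in> complement (convex_span e) \<and> r = ratio e c / of_int k"
  then obtain l c' d' where l: "0 < l" "l \<cdot> x = c' + d'" and c': "c' \<in> convex_span e"
    and d': "d' \<in> complement (convex_span e)" and r: "r = ratio e c' / of_int l" by blast
  note C = subspace_convex_span[OF e]
  have "l \<cdot> c + l \<cdot> d = k \<cdot> c' + k \<cdot> d'"
    using arg_cong[OF k(2), of "(\<cdot>) l"] arg_cong[OF l(2), of "(\<cdot>) k"]
    by (simp add: int_module.scale_right_distrib mult.commute)
  then have eq: "l \<cdot> c - k \<cdot> c' = k \<cdot> d' - l \<cdot> d" by (simp add: algebra_simps)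
  have "l \<cdot> c - k \<cdot> c' \<in> convex_span e"
    by (intro int_module.subspace_diff[OF C] int_module.subspace_scale[OF C] c c')
  moreover have "k \<cdot> d' - l \<cdot> d \<in> complement (convex_span e)"
    using d d' unfolding complement_def
    by (intro int_module.span_diff int_module.span_scale)
  ultimately have "l \<cdot> c = k \<cdot> c'" using complement_disjoint[OF C] eq by force
  then have "of_int l * ratio e c = of_int k * ratio e c'"
    using ratio_multiple[OF e c l(1)] ratio_multiple[OF e c' k(1)] by simp
  then show "r = ratio e c / of_int k" using k(1) l(1) by (simp add: r field_simps)
qed

lemma coefficient_convex_span:
  assumes "0 < e" "x \<in> convex_span e"
  shows "coefficient e x = ratio e x"
  using coefficient_eq[OF assms(1), of 1 x x 0] assms(2) by (simp add: complement_def int_module.span_zero)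

lemma coefficient_add:
  assumes e: "0 < e"
  shows "coefficient e (x + y) = coefficient e x + coefficient e y"
proof -
  note C = subspace_convex_span[OF e]
  obtain k c d where k: "0 < k" "k \<cdot> x = c + d" and c: "c \<in> convex_span e"
    and d: "d \<in> complement (convex_span e)" using complement_decomp[OF C] .
  obtain l c' d' where l: "0 < l" "l \<cdot> y = c' + d'" and c': "c' \<in> convex_span e"
    and d': "d' \<in> complement (convex_span e)" using complement_decomp[OF C] .
  have lc: "l \<cdot> c \<in> convex_span e" "k \<cdot> c' \<in> convex_span e"
    by (intro int_module.subspace_scale[OF C] c c')+
  have "coefficient e (x + y) = ratio e (l \<cdot> c + k \<cdot> c') / of_int (k * l)"
  proof (rule coefficient_eq[OF e])
    have "(k * l) \<cdot> (x + y) = l \<cdot> k \<cdot> x + k \<cdot> l \<cdot> y"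
      by (simp add: int_module.scale_right_distrib mult.commute)
    then show "(k * l) \<cdot> (x + y) = (l \<cdot> c + k \<cdot> c') + (l \<cdot> d + k \<cdot> d')"
      by (simp only: k l int_module.scale_right_distrib add_ac)
    show "l \<cdot> c + k \<cdot> c' \<in> convex_span e" by (intro int_module.subspace_add[OF C] lc)
    show "l \<cdot> d + k \<cdot> d' \<in> complement (convex_span e)"
      using d d' unfolding complement_def by (intro int_module.span_add int_module.span_scale)
  qed (use k l in simp)
  also have "\<dots> = (of_int l * ratio e c + of_int k * ratio e c') / of_int (k * l)"
    using k l c c' by (simp add: ratio_add[OF e lc] ratio_multiple[OF e])
  also have "\<dots> = ratio e c / of_int k + ratio e c' / of_int l"
    using k(1) l(1) by (simp add: field_simps)
  finally show ?thesis
    by (simp add: coefficient_eq[OF e k c d] coefficient_eq[OF e l c' d'])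
qed

section \<open>The Hahn embedding\<close>

text \<open>The coefficient of \<open>f x\<close> at \<open>h\<close> is the functional of a representative \<open>e h\<close> of the class
  labelled \<open>h\<close>.  For \<open>x > 0\<close> the functional of the class of \<open>x\<close> is positive at \<open>x\<close>, while
  the functionals of all larger classes, which have smaller labels, vanish there; hence \<open>f\<close> is
  order preserving.\<close>

theorem hahn_embedding:
  fixes w :: "'a::linordered_ab_group_add \<Rightarrow> 'h::linordered_ab_group_add"
  assumes w: "\<And>a b. 0 < a \<Longrightarrow> 0 < b \<Longrightarrow> w a \<le> w b \<longleftrightarrow> b \<in> convex_span a"
  obtains f :: "'a \<Rightarrow> 'h hahn" where "\<And>x y. f (x + y) = f x + f y" "\<And>x. 0 < x \<Longrightarrow> 0 < f x"
    "\<And>x. hsupp (f x) \<subseteq> w ` {0<..}"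
proof -
  define V where "V = w ` {0<..}"
  define e where "e = inv_into {0<..} w"
  have e: "0 < e h" "w (e h) = h" if "h \<in> V" for h
    using inv_into_into[of h w "{0<..}"] f_inv_into_f[of h w "{0<..}"] that
    by (auto simp: e_def V_def)
  have smaller: "e h' \<notin> convex_span (e h)" "convex_span (e h) \<subseteq> convex_span (e h')"
    if "h \<in> V" "h' \<in> V" "h' < h" for h h'
    using w[of "e h" "e h'"] w[of "e h'" "e h"] that e[OF that(1)] e[OF that(2)]
      convex_span_subset_iff[of "e h" "e h'"] by auto
  define c where "c = (\<lambda>x h. if h \<in> V then coefficient (e h) x else 0)"
  have wo_c: "well_ordered_set {h. c x h \<noteq> 0}" for x
    unfolding well_ordered_set_def
  proof (intro allI impI, rule ccontr)
    \<comment> \<open>If \<open>T\<close> has no least element, decompose \<open>x\<close> with respect to the union \<open>U\<close> of the convex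
      subgroups of all labels in \<open>T\<close>.  The part in \<open>U\<close> already lies in the subgroup of one label
      \<open>g\<close> and is infinitesimal for every smaller label \<open>h\<close> in \<open>T\<close>; the part in the complement of
      \<open>U\<close> lies in the complement of the smaller subgroup for \<open>h\<close>.  Thus the coefficient at
      \<open>h\<close> vanishes.\<close>
    fix T assume T: "T \<subseteq> {h. c x h \<noteq> 0}" "T \<noteq> {}" and "\<not> (\<exists>m\<in>T. \<forall>x\<in>T. m \<le> x)"
    then have nomin: "\<And>m. m \<in> T \<Longrightarrow> \<exists>h\<in>T. h < m" by (meson not_le)
    have TV: "h \<in> V" "coefficient (e h) x \<noteq> 0" if "h \<in> T" for h
      using T(1) that by (auto simp: c_def split: if_splits)
    define U where "U = (\<Union>h\<in>T. convex_span (e h))"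
    have sub: "int_module.subspace (convex_span (e h))" if "h \<in> T" for h
      using subspace_convex_span e(1) TV(1) that by blast
    have "int_module.subspace U"
    proof (rule int_module.subspaceI)
      show "0 \<in> U" using T(2) int_module.subspace_0[OF sub] by (auto simp: U_def)
      show "k \<cdot> u \<in> U" if "u \<in> U" for k u
        using that int_module.subspace_scale[OF sub] by (auto simp: U_def)
      fix u v assume "u \<in> U" "v \<in> U"
      then obtain g h where gh: "g \<in> T" "u \<in> convex_span (e g)" "h \<in> T" "v \<in> convex_span (e h)"
        by (auto simp: U_def)
      have "min g h \<in> T" using gh by (simp add: min_def)
      moreover have "u \<in> convex_span (e (min g h))" "v \<in> convex_span (e (min g h))"
        using gh smaller(2)[of g h] smaller(2)[of h g] TV(1)
        by (cases g h rule: linorder_cases; auto simp: min_def)+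
      ultimately show "u + v \<in> U"
        using int_module.subspace_add[OF sub] unfolding U_def by blast
    qed
    then obtain k u d where k: "0 < k" "k \<cdot> x = u + d" and "u \<in> U" and d: "d \<in> complement U"
      using complement_decomp by blast
    then obtain g where g: "g \<in> T" "u \<in> convex_span (e g)" by (auto simp: U_def)
    then obtain h where h: "h \<in> T" "h < g" using nomin by blast
    have V: "g \<in> V" "h \<in> V" using TV(1) g h by auto
    note inf = ratio_infinitesimal[OF e(1)[OF V(1)] e(1)[OF V(2)] g(2) smaller(1)[OF V h(2)]]
    have "d \<in> complement (convex_span (e h))"
      using d complement_antimono[of "convex_span (e h)" U] h(1) by (auto simp: U_def)
    then have "coefficient (e h) x = 0"
      using coefficient_eq[OF e(1)[OF V(2)] k inf(1)] inf(2) by simp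
    then show False using TV(2) h(1) by blast
  qed
  define f where "f = (\<lambda>x. Abs_hahn (c x))"
  have f: "hcoeff (f x) h = c x h" for x h
    unfolding f_def by (rule hcoeff_Abs[OF wo_c]) simp
  show thesis
  proof (rule that)
    show "f (x + y) = f x + f y" for x y
      by (rule hahn_eqI) (simp add: f c_def coefficient_add e)
    show "hsupp (f x) \<subseteq> w ` {0<..}" for x
      by (auto simp: hsupp_def f c_def V_def split: if_splits)
  next
    fix x :: 'a assume x: "0 < x"
    then have V: "w x \<in> V" by (auto simp: V_def)
    note ex = e[OF V]
    have "x \<in> convex_span (e (w x))" "e (w x) \<in> convex_span x"
      using w[OF ex(1) x] w[OF x ex(1)] ex by auto
    then have "0 < hcoeff (f x) (w x)"
      using V ratio_pos[OF ex(1) x] coefficient_convex_span[OF ex(1)] by (simp add: f c_def)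
    moreover have "hcoeff (f x) h = 0" if h: "h < w x" for h
    proof (cases "h \<in> V")
      case True
      have "e h \<notin> convex_span x" using w[OF x e(1)[OF True]] e[OF True] h by auto
      note inf = ratio_infinitesimal[OF x e(1)[OF True] convex_span_self[OF x] this]
      show ?thesis using True coefficient_convex_span[OF e(1)[OF True] inf(1)] inf(2) by (simp add: f c_def)
    qed (simp add: f c_def)
    ultimately show "0 < f x" unfolding hahn_pos_iff by blast
  qed
qed

section \<open>The positive elements of an ordered field as an ordered group\<close>

text \<open>The multiplicative group is written additively, so that the theorem on ordered abelian
  groups applies to it.\<close>

typedef (overloaded) 'a positive = "{x::'a::linordered_field. 0 < x}"
  morphisms of_positive Positive
  by (rule exI[of _ 1]) simp

lemma of_positive_pos: "0 < of_positive p"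
  using of_positive[of p] by simp

instantiation positive :: (linordered_field) linordered_ab_group_add
begin

definition zero_positive :: "'a positive" where "0 = Positive 1"
definition plus_positive :: "'a positive \<Rightarrow> 'a positive \<Rightarrow> 'a positive" where
  "p + q = Positive (of_positive p * of_positive q)"
definition uminus_positive :: "'a positive \<Rightarrow> 'a positive" where
  "- p = Positive (inverse (of_positive p))"
definition minus_positive :: "'a positive \<Rightarrow> 'a positive \<Rightarrow> 'a positive" where
  "p - q = p + - (q :: 'a positive)"
definition less_eq_positive :: "'a positive \<Rightarrow> 'a positive \<Rightarrow> bool" where
  "p \<le> q \<longleftrightarrow> of_positive p \<le> of_positive q"
definition less_positive :: "'a positive \<Rightarrow> 'a positive \<Rightarrow> bool" where
  "p < q \<longleftrightarrow> of_positive p < of_positive q"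

lemma of_positive_zero: "of_positive (0 :: 'a positive) = 1"
  by (simp add: zero_positive_def Positive_inverse)

lemma of_positive_add: "of_positive (p + q :: 'a positive) = of_positive p * of_positive q"
  by (simp add: plus_positive_def Positive_inverse of_positive_pos)

lemma of_positive_minus: "of_positive (- p :: 'a positive) = inverse (of_positive p)"
  by (simp add: uminus_positive_def Positive_inverse of_positive_pos)

instance
proof
  fix a b c :: "'a positive"
  show "- a + a = 0" using of_positive_pos[of a]
    by (simp add: of_positive_inject[symmetric] of_positive_add of_positive_minus of_positive_zero)
  show "a \<le> b \<Longrightarrow> c + a \<le> c + b" using of_positive_pos[of c]
    by (simp add: less_eq_positive_def of_positive_add)
qed (auto simp: minus_positive_def less_eq_positive_def less_positive_def of_positive_inject[symmetric]
    of_positive_add of_positive_zero mult_ac)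

end

lemma of_positive_nat_multiple: "of_positive (nat_multiple n p) = of_positive p ^ n"
  by (induction n) (simp_all add: of_positive_zero of_positive_add)

section \<open>The valuation of a power series field\<close>

definition hval :: "'g::linordered_ab_group_add hahn \<Rightarrow> 'g" where
  "hval x = (LEAST g. hcoeff x g \<noteq> 0)"

lemma hval_eqI:
  assumes "hcoeff x g \<noteq> 0" "\<And>h. h < g \<Longrightarrow> hcoeff x h = 0"
  shows "hval x = g"
  unfolding hval_def by (rule Least_equality) (use assms in \<open>auto intro: leI\<close>)

lemma hval_leading:
  assumes "x \<noteq> 0"
  shows "hcoeff x (hval x) \<noteq> 0" "h < hval x \<Longrightarrow> hcoeff x h = 0"
proof -
  obtain g where g: "hcoeff x g \<noteq> 0" "\<And>h. h < g \<Longrightarrow> hcoeff x h = 0"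
    using hahn_first_difference[OF assms] by auto
  then have "hval x = g" by (rule hval_eqI)
  then show "hcoeff x (hval x) \<noteq> 0" "h < hval x \<Longrightarrow> hcoeff x h = 0" using g by auto
qed

lemma hval_leading_pos: "0 < x \<Longrightarrow> 0 < hcoeff x (hval x)"
  unfolding hahn_pos_iff by (metis hval_eqI less_irrefl)

lemma hval_mult:
  assumes "x \<noteq> 0" "y \<noteq> 0"
  shows "hval (x * y) = hval x + hval y"
  by (rule hval_eqI)
    (use hcoeff_mult_leading[of "hval x" x "hval y" y] hval_leading[OF assms(1)] hval_leading[OF assms(2)] in auto)

lemma hval_one: "hval 1 = 0"
  by (rule hval_eqI) (simp_all add: hcoeff_1)

lemma hval_power: "x \<noteq> 0 \<Longrightarrow> hval (x ^ n) = nat_multiple n (hval x)"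
  by (induction n) (simp_all add: hval_one hval_mult)

lemma hcoeff_of_nat_mult: "hcoeff (of_nat n * x) g = of_nat n * hcoeff x g"
  by (induction n) (simp_all add: distrib_right)

lemma less_if_hval_less:
  assumes "0 < x" "0 < y" "hval x < hval y"
  shows "of_nat n * y < x"
  unfolding less_hahn_def
proof (intro exI[of _ "hval x"] conjI allI impI)
  show "hcoeff (of_nat n * y) (hval x) < hcoeff x (hval x)"
    using assms hval_leading(2)[of y "hval x"] hval_leading_pos by (auto simp: hcoeff_of_nat_mult)
  fix h assume "h < hval x"
  then show "hcoeff (of_nat n * y) h = hcoeff x h"
    using assms hval_leading(2)[of y h] hval_leading(2)[of x h] by (auto simp: hcoeff_of_nat_mult)
qed

lemma hval_antimono: "0 < y \<Longrightarrow> y \<le> x \<Longrightarrow> hval x \<le> hval y"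
  using less_if_hval_less[of y x 1] by (force intro: leI)

lemma bounded_if_hval_le:
  assumes "0 < x" "0 < y" "hval x \<le> hval y"
  obtains n :: nat where "y \<le> of_nat n * x"
proof (cases "hval x = hval y")
  case False
  then have "hval x < hval y" using assms(3) by simp
  then show ?thesis using less_if_hval_less[OF assms(1,2), of 1] that[of 1] by (simp add: less_imp_le)
next
  case True
  obtain n where n: "hcoeff y (hval x) < real n * hcoeff x (hval x)"
    using reals_Archimedean3[OF hval_leading_pos[OF assms(1)]] by blast
  have "y < of_nat n * x"
    unfolding less_hahn_def hcoeff_of_nat_mult
    using n hval_leading(2)[of x] hval_leading(2)[of y] assms True
    by (intro exI[of _ "hval x"]) auto
  then show ?thesis by (intro that less_imp_le)
qed

section \<open>Archimedean classes of the multiplicative group\<close>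

lemma power_minus_one_lower:
  fixes x :: "'a::linordered_field"
  assumes "1 \<le> x"
  shows "of_nat n * (x - 1) \<le> x ^ n - 1"
proof (induction n)
  case (Suc n)
  have "0 \<le> (x - 1) * (x ^ n - 1)" using assms by simp
  moreover have "x ^ Suc n - 1 = (x ^ n - 1) + (x - 1) + (x - 1) * (x ^ n - 1)" by (simp add: algebra_simps)
  ultimately show ?case using Suc by (simp add: distrib_right)
qed simp

lemma power_minus_one_upper:
  fixes x :: "'a::linordered_field"
  assumes "1 \<le> x" "x \<le> of_nat N"
  shows "\<exists>M. x ^ n - 1 \<le> of_nat M * (x - 1)"
proof (induction n)
  case (Suc n)
  then obtain M where M: "x ^ n - 1 \<le> of_nat M * (x - 1)" by blast
  have "x * (x ^ n - 1) \<le> of_nat N * (of_nat M * (x - 1))"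
    using assms M by (intro mult_mono) auto
  then have "x ^ Suc n - 1 \<le> of_nat (N * M + 1) * (x - 1)" by (simp add: algebra_simps)
  then show ?case by blast
qed (auto intro: exI[of _ 0])

text \<open>This direction is Bernoulli's inequality, and it holds for all signs of the
  valuations.\<close>

lemma power_dominates_if_hval_le:
  fixes x y :: "'g::linordered_ab_group_add hahn"
  assumes "1 < x" "1 < y" "hval (x - 1) \<le> hval (y - 1)"
  shows "\<exists>n. y \<le> x ^ n"
proof -
  obtain n :: nat where "y - 1 \<le> of_nat n * (x - 1)"
    using bounded_if_hval_le[of "x - 1" "y - 1"] assms by auto
  also have "\<dots> \<le> x ^ n - 1" using assms(1) by (intro power_minus_one_lower) simp
  finally show ?thesis by auto
qed

text \<open>As \<open>x\<close> is bounded by a natural number, \<open>x ^ n - 1\<close> is bounded by a natural multiple of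
  \<open>x - 1\<close>.\<close>

lemma power_bounded_if_finite:
  fixes x y :: "'g::linordered_ab_group_add hahn"
  assumes "1 < x" "1 < y" "0 \<le> hval (x - 1)" "hval (y - 1) < hval (x - 1)"
  shows "x ^ n < y"
proof -
  obtain N :: nat where "x - 1 \<le> of_nat N * 1"
    using bounded_if_hval_le[of 1 "x - 1"] assms by (auto simp: hval_one)
  then have "x \<le> of_nat (Suc N)" by (simp add: algebra_simps)
  then obtain M where "x ^ n - 1 \<le> of_nat M * (x - 1)" using power_minus_one_upper[of x "Suc N" n] assms(1) by auto
  also have "\<dots> < y - 1" using assms by (intro less_if_hval_less) auto
  finally show ?thesis by simp
qed

lemma hval_minus_one:
  assumes "hval (x - 1) < 0" "1 < x"
  shows "hval x = hval (x - 1)"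
proof (rule hval_eqI)
  have "x - 1 \<noteq> 0" using assms(2) by simp
  note l = hval_leading[OF this]
  show "hcoeff x (hval (x - 1)) \<noteq> 0" using l(1) less_imp_neq[OF assms(1)] by (simp add: hcoeff_1)
  show "hcoeff x h = 0" if "h < hval (x - 1)" for h using l(2)[OF that] that assms(1) by (simp add: hcoeff_1)
qed

text \<open>For infinite elements the valuation turns multiplicative into additive domination:
  a natural factor between \<open>y\<close> and \<open>x ^ n\<close> is absorbed by one more factor \<open>x\<close>.\<close>

lemma infinite_power_dominates_iff:
  fixes x y :: "'g::linordered_ab_group_add hahn"
  assumes "1 < x" "1 < y" "hval (x - 1) < 0" "hval (y - 1) < 0"
  shows "(\<exists>n. y \<le> x ^ n) \<longleftrightarrow> - hval (y - 1) \<in> convex_span (- hval (x - 1))"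
proof -
  have neg: "nat_multiple n (- g) = - nat_multiple n g" for n and g :: 'g
    by (induction n) simp_all
  have vx: "hval (x - 1) = hval x" and vy: "hval (y - 1) = hval y" using hval_minus_one assms by metis+
  have "(\<exists>n. y \<le> x ^ n) \<longleftrightarrow> (\<exists>n. hval (x ^ n) \<le> hval y)"
  proof
    show "\<exists>n. y \<le> x ^ n \<Longrightarrow> \<exists>n. hval (x ^ n) \<le> hval y" using hval_antimono assms(2) by (meson less_trans zero_less_one)
  next
    assume "\<exists>n. hval (x ^ n) \<le> hval y"
    then obtain n where "hval (x ^ n) \<le> hval y" by blast
    then obtain M :: nat where M: "y \<le> of_nat M * x ^ n"
      using bounded_if_hval_le[of "x ^ n" y] assms(1,2) by auto
    have "of_nat M < x" using less_if_hval_less[of x 1 M] assms(1,3) vx by (simp add: hval_one)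
    then have "of_nat M * x ^ n \<le> x * x ^ n" using assms(1) by (intro mult_right_mono) auto
    then show "\<exists>n. y \<le> x ^ n" using M by (intro exI[of _ "Suc n"]) simp
  qed
  also have "\<dots> \<longleftrightarrow> - hval (y - 1) \<in> convex_span (- hval (x - 1))"
    using convex_span_pos_iff[of "- hval x" "- hval y"] assms by (auto simp: vx vy neg hval_power)
  finally show ?thesis .
qed

text \<open>The choice depends on the convex span of \<open>e\<close> only, so archimedean equivalent elements
  share their representative.\<close>

definition arch_rep :: "'a::linordered_ab_group_add \<Rightarrow> 'a" where
  "arch_rep e = (SOME a. 0 < a \<and> convex_span a = convex_span e)"

lemma arch_rep:
  assumes "0 < e"
  shows "0 < arch_rep e" "convex_span (arch_rep e) = convex_span e"
  using someI_ex[of "\<lambda>a. 0 < a \<and> convex_span a = convex_span e"] assms by (auto simp: arch_rep_def)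

lemma arch_rep_cong: "convex_span a = convex_span b \<Longrightarrow> arch_rep a = arch_rep b"
  by (simp add: arch_rep_def)

lemma arch_rep_le_iff:
  assumes "0 < a" "0 < b"
  shows "arch_rep a \<le> arch_rep b \<longleftrightarrow> a \<in> convex_span b"
proof
  note r = arch_rep[OF assms(1)] arch_rep[OF assms(2)]
  assume "arch_rep a \<le> arch_rep b"
  then have "arch_rep a \<in> convex_span (arch_rep b)"
    using convex_span_between[OF convex_span_self[OF r(3)]] r(1,3)
    by (meson less_imp_le neg_le_0_iff_le order_trans)
  then show "a \<in> convex_span b" using convex_span_subset_iff r assms by metis
next
  note r = arch_rep[OF assms(1)] arch_rep[OF assms(2)]
  assume ab: "a \<in> convex_span b"
  show "arch_rep a \<le> arch_rep b"
  proof (rule ccontr)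
    assume "\<not> ?thesis"
    then have "arch_rep b \<in> convex_span (arch_rep a)"
      using convex_span_between[OF convex_span_self[OF r(1)]] r(1,3)
      by (meson less_imp_le neg_le_0_iff_le order_trans not_le)
    then have "b \<in> convex_span a" using convex_span_subset_iff r assms by metis
    then have "convex_span a = convex_span b" using ab convex_span_subset_iff assms by blast
    from arch_rep_cong[OF this] \<open>\<not> ?thesis\<close> show False by simp
  qed
qed

text \<open>A representative and its double are equivalent, and each class has only one
  representative.\<close>

lemma double_not_arch_rep:
  assumes "0 < g" "0 < h"
  shows "arch_rep g + arch_rep g \<noteq> arch_rep h"
proof
  let ?e = "arch_rep g"
  assume eq: "?e + ?e = arch_rep h"
  have e: "0 < ?e" "?e < ?e + ?e" using arch_rep(1)[OF assms(1)] by auto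
  have "?e + ?e \<in> convex_span ?e"
    using int_module.subspace_add[OF subspace_convex_span] convex_span_self e(1) by blast
  then have "arch_rep h \<in> convex_span g" using arch_rep[OF assms(1)] eq by metis
  then have "h \<in> convex_span g" using convex_span_subset_iff arch_rep assms by metis
  then have "arch_rep h \<le> ?e" using arch_rep_le_iff assms by blast
  then show False using eq e by simp
qed

text \<open>The label of the multiplicative archimedean class of \<open>x > 1\<close>.  The minus signs make larger
  classes correspond to smaller exponents.\<close>

definition log_exponent :: "'g::linordered_ab_group_add hahn \<Rightarrow> 'g" where
  "log_exponent x = (let v = hval (x - 1) in if v < 0 then - arch_rep (- v) else v)"

lemma log_exponent_le_iff:
  fixes x y :: "'g::linordered_ab_group_add hahn"
  assumes "1 < x" "1 < y"
  shows "log_exponent x \<le> log_exponent y \<longleftrightarrow> (\<exists>n. y \<le> x ^ n)"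
proof -
  let ?a = "hval (x - 1)" and ?b = "hval (y - 1)"
  consider "?a < 0" "?b < 0" | "?a < 0" "0 \<le> ?b" | "0 \<le> ?a" "?a \<le> ?b" | "0 \<le> ?a" "?b < ?a"
    by (meson not_le)
  then show ?thesis
  proof cases
    case 1
    then show ?thesis
      using infinite_power_dominates_iff[OF assms 1] arch_rep_le_iff[of "- ?b" "- ?a"]
      by (simp add: log_exponent_def)
  next
    case 2
    then have "\<exists>n. y \<le> x ^ n" using power_dominates_if_hval_le[OF assms] by simp
    moreover have "- arch_rep (- ?a) \<le> ?b"
      using 2 arch_rep(1)[of "- ?a"] by (meson less_imp_le neg_le_0_iff_le neg_0_less_iff_less order_trans)
    ultimately show ?thesis using 2 by (auto simp: log_exponent_def Let_def)
  next
    case 3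
    then show ?thesis using power_dominates_if_hval_le[OF assms] by (auto simp: log_exponent_def Let_def)
  next
    case 4
    then have none: "\<not> (\<exists>n. y \<le> x ^ n)" using power_bounded_if_finite[OF assms] by (simp add: not_le)
    have "- arch_rep (- ?b) < ?a" if "?b < 0"
      using 4 that arch_rep(1)[of "- ?b"] by (meson less_le_trans neg_less_0_iff_less neg_0_less_iff_less)
    then have "log_exponent y < log_exponent x"
      using 4 by (auto simp: log_exponent_def Let_def)
    then show ?thesis using none by (auto simp: not_le[symmetric])
  qed
qed

theorem corollary6:
  assumes nontrivial: "\<exists>g::'g::linordered_ab_group_add. g \<noteq> 0"
    and divisible: "\<forall>n::nat. n > 0 \<longrightarrow> (\<forall>g::'g. \<exists>h. (\<Sum>i<n. h) = g)"
  shows "\<exists>L :: 'g hahn \<Rightarrow> 'g hahn. is_logarithm L \<and> L ` {0<..} \<noteq> UNIV"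
proof -
  define w where "w = (\<lambda>p :: 'g hahn positive. log_exponent (of_positive p))"
  have pos: "0 < p \<longleftrightarrow> 1 < of_positive p" for p :: "'g hahn positive"
    by (simp add: less_positive_def of_positive_zero)
  have w: "w p \<le> w q \<longleftrightarrow> q \<in> convex_span p" if "0 < p" "0 < q" for p q
    using log_exponent_le_iff convex_span_pos_iff[OF that] that
    by (simp add: w_def pos less_eq_positive_def of_positive_nat_multiple)
  obtain f :: "'g hahn positive \<Rightarrow> 'g hahn" where add: "\<And>p q. f (p + q) = f p + f q"
    and f_pos: "\<And>p. 0 < p \<Longrightarrow> 0 < f p" and supp: "\<And>p. hsupp (f p) \<subseteq> w ` {0<..}"
    by (rule hahn_embedding[OF w]) (assumption | rule that)+
  have mono: "f p < f q" if "p < q" for p q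
    using f_pos[of "q - p"] add[of "q - p" p] that by simp
  define L where "L = (\<lambda>x. f (Positive x))"
  have "L (x * y) = L x + L y" if "0 < x" "0 < y" for x y
    using that by (simp add: L_def add[symmetric] plus_positive_def Positive_inverse)
  moreover have strict: "strict_mono_on {0<..} L"
    by (rule strict_mono_onI) (auto simp: L_def less_positive_def Positive_inverse intro!: mono)
  ultimately have log: "is_logarithm L"
    by (simp add: is_logarithm_def strict_mono_on_imp_inj_on)
  obtain g :: 'g where g: "0 < g"
    using nontrivial by (metis linorder_neqE neg_0_less_iff_less)
  \<comment> \<open>A negative exponent equivalent to a label without being one.\<close>
  define h where "h = - (arch_rep g + arch_rep g)"
  have "h < 0" using arch_rep(1)[OF g] by (simp add: h_def add_pos_pos)
  have missed: "h \<noteq> log_exponent x" for x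
  proof
    assume "h = log_exponent x"
    then have "h = - arch_rep (- hval (x - 1))" "hval (x - 1) < 0"
      using \<open>h < 0\<close> by (auto simp: log_exponent_def Let_def split: if_splits)
    then show False using double_not_arch_rep[OF g, of "- hval (x - 1)"]
      unfolding h_def neg_equal_iff_equal by simp
  qed
  have "hmonom 1 h \<notin> L ` {0<..}"
  proof
    assume "hmonom 1 h \<in> L ` {0<..}"
    then obtain p where "f p = hmonom 1 h" by (auto simp: L_def)
    then have "h \<in> hsupp (f p)" by (simp add: hsupp_def hcoeff_hmonom)
    then show False using supp missed by (auto simp: w_def)
  qed
  then show ?thesis using log by blast
qed

end
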